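(* Let $R$ be a commutative ring with identity and let $(A,B)$ be an algebraic quasi-Cartan pair over $R$. Let $\Sigma$ be the groupoid of ultrafilters of $N(B)$ and let $G=\Sigma/{\simeq}$ be its quotient by the relation $U\simeq W\iff U=tW$ for some $t\in R^\times$. Then (a) $(A,B)$ is an algebraic Cartan pair if and only if $G$ is effective, and (b) $(A,B)$ is an algebraic diagonal pair if and only if $G$ is principal.
   Context: $R^\times$ denotes the group of units of $R$. **Normalisers.** For an $R$-algebra $A$ and commutative subalgebra $B$, $I(B)$ is the set of idempotents of $B$; it is a set of local units for $A$ if for every finite $\{a_1,\dots,a_n\}\subseteq A$ there is $e\in I(B)$ with $ea_i=a_i=a_ie$ for all $i$. $N(B)=\{n\in A:\exists k\in A,\ knk=k,\ nkn=n,\ kBn\cup nBk\subseteq B\}$. For $n\in N(B)$, $k$ is unique, denoted $n^\dagger$; $N(B)$ is an inverse semigroup with idempotent set $I(B)$ and partial order $n\le m\iff n=nn^\dagger m$. A normaliser $n\in N(B)$ is free if $n\in B$ or $(n^\dagger n)(nn^\dagger)=0$. **Algebraic pairs.** A conditional expectation $P\colon A\to B$ is an $R$-linear map with $P|_B=\mathrm{id}_B$ and $P(bab')=bP(a)b'$ for $a\in A$, $b,b'\in B$. It is faithful if for all $a\in A\setminus\{0\}$ there is $n\in N(B)$ with $P(na)\neq0$, and implemented by idempotents if for each $n\in N(B)$ there is $e\in I(B)$ with $P(n)=ne=en$. Let $B\subseteq A$ be a commutative subalgebra such that: $te=0$ with $t\in R$, $e\in I(B)\setminus\{0\}$ implies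 $t=0$; $I(B)$ is a set of local units for $A$; $B=\operatorname{span}_RI(B)$; $A=\operatorname{span}_RN(B)$; and there is a faithful conditional expectation $A\to B$. Then $(A,B)$ is an algebraic diagonal pair if $A$ is spanned by the free normalisers of $B$; an algebraic Cartan pair if $B$ is a maximal commutative subalgebra of $A$; an algebraic quasi-Cartan pair if there is a faithful conditional expectation $P\colon A\to B$ implemented by idempotents. **The groupoids $\Sigma$ and $G$.** For $U\subseteq N(B)$ let $U^\uparrow=\{m\in N(B):n\le m\text{ for some }n\in U\}$. A filter is $U\subseteq N(B)\setminus\{0\}$ with $U=U^\uparrow$ such that any two elements of $U$ have a common lower bound in $U$; an ultrafilter is a maximal (nonempty) filter. $\Sigma$ is the set of ultrafilters with $U^{-1}=\{n^\dagger:n\in U\}$; $(U,V)$ composable iff $mn\ne0$ for all $m\in U,n\in V$, and then $UV=\{mn:m\in U,n\in V\}^\uparrow$; $s(U)=U^{-1}U$, $r(U)=UU^{-1}$, $\Sigma^{(0)}=\{U:U\cap I(B)\neq\varnothing\}$. The sets $\mathcal V_n=\{U\in\Sigma:n\in U\}$ ($n\in N(B)$) form a basis of the topology. For $t\in R^\times$, $tU=\{tm:m\in U\}\in\Sigma$. $G=\Sigma/{\simeq}$ has the quotient topology and, with $q$ the quotient map, the structure $q(U)^{-1}=q(U^{-1})$, $q(U)q(W)=q(UW)$ for composable $(U,W)$; $G^{(0)}=q(\Sigma^{(0)})$. A groupoid $G$ is principal if $\operatorname{Iso}(G)=\{\gamma:r(\gamma)=s(\gamma)\}$ equals $G^{(0)}$,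 and effective if the topological interior of $\operatorname{Iso}(G)$ equals $G^{(0)}$. *)

theory Defs
  imports "HOL-Analysis.Analysis"
begin

section \<open>Algebras over a commutative ring\<close>

text \<open>
  The scalars have sort \<open>{comm_ring, comm_monoid_mult}\<close>, i.e. a commutative ring with identity.
  The class \<open>comm_ring_1\<close>, which the library locale \<open>module\<close> requires, would in addition demand
  that zero and one are different. The algebra is an associative ring, not necessarily unital and
  not necessarily commutative. The lemmas below confirm that the notions are those of the library
  whenever the latter apply.
\<close>

locale ring_algebra =
  fixes smul :: "'r::{comm_ring,comm_monoid_mult} \<Rightarrow> 'a::ring \<Rightarrow> 'a"
  assumes smul_add_right: "smul t (a + b) = smul t a + smul t b"
    and smul_add_left: "smul (s + t) a = smul s a + smul t a"
    and smul_smul: "smul s (smul t a) = smul (s * t) a"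
    and smul_one: "smul 1 a = a"
    and smul_mult_left: "smul t a * b = smul t (a * b)"
    and smul_mult_right: "a * smul t b = smul t (a * b)"

definition lin_span :: "('r \<Rightarrow> 'a \<Rightarrow> 'a) \<Rightarrow> 'a set \<Rightarrow> 'a::ring set" where
  "lin_span smul S = {(\<Sum>a\<in>F. smul (c a) a) | F c. finite F \<and> F \<subseteq> S}"

lemma ring_algebra_iff_module:
  fixes smul :: "'r::comm_ring_1 \<Rightarrow> 'a::ring \<Rightarrow> 'a"
  shows "ring_algebra smul \<longleftrightarrow> module smul \<and>
    (\<forall>t a b. smul t a * b = smul t (a * b) \<and> a * smul t b = smul t (a * b))"
  unfolding ring_algebra_def module_def by blast

lemma lin_span_eq_span:
  fixes smul :: "'r::comm_ring_1 \<Rightarrow> 'a::ring \<Rightarrow> 'a"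
  assumes "module smul"
  shows "lin_span smul S = module.span smul S"
  unfolding lin_span_def module.span_explicit[OF assms] by simp

definition scalar_units :: "'r::{comm_ring,comm_monoid_mult} set" where
  "scalar_units = {t. t dvd 1}"

definition subalgebra :: "('r \<Rightarrow> 'a \<Rightarrow> 'a) \<Rightarrow> 'a::ring set \<Rightarrow> bool" where
  "subalgebra smul B \<longleftrightarrow> 0 \<in> B \<and> (\<forall>a\<in>B. \<forall>b\<in>B. a + b \<in> B) \<and> (\<forall>t. \<forall>a\<in>B. smul t a \<in> B) \<and>
     (\<forall>a\<in>B. \<forall>b\<in>B. a * b \<in> B)"

definition comm_subalgebra :: "('r \<Rightarrow> 'a \<Rightarrow> 'a) \<Rightarrow> 'a::ring set \<Rightarrow> bool" where
  "comm_subalgebra smul B \<longleftrightarrow> subalgebra smul B \<and> (\<forall>a\<in>B. \<forall>b\<in>B. a * b = b * a)"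

definition maximal_comm_subalgebra :: "('r \<Rightarrow> 'a \<Rightarrow> 'a) \<Rightarrow> 'a::ring set \<Rightarrow> bool" where
  "maximal_comm_subalgebra smul B \<longleftrightarrow> comm_subalgebra smul B \<and>
     (\<forall>C. comm_subalgebra smul C \<and> B \<subseteq> C \<longrightarrow> C = B)"


section \<open>Normalisers\<close>

definition idems :: "'a::ring set \<Rightarrow> 'a set" where
  "idems B = {e \<in> B. e * e = e}"

definition local_units :: "'a::ring set \<Rightarrow> bool" where
  "local_units E \<longleftrightarrow> (\<forall>F. finite F \<longrightarrow> (\<exists>e\<in>E. \<forall>a\<in>F. e * a = a \<and> a = a * e))"

definition normaliser_inverse :: "'a::ring set \<Rightarrow> 'a \<Rightarrow> 'a \<Rightarrow> bool" where
  "normaliser_inverse B n k \<longleftrightarrow> k * n * k = k \<and> n * k * n = n \<and>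
     (\<forall>b\<in>B. k * b * n \<in> B \<and> n * b * k \<in> B)"

definition normalisers :: "'a::ring set \<Rightarrow> 'a set" where
  "normalisers B = {n. \<exists>k. normaliser_inverse B n k}"

definition dagger :: "'a::ring set \<Rightarrow> 'a \<Rightarrow> 'a" where
  "dagger B n = (THE k. normaliser_inverse B n k)"

text \<open>The natural partial order; meaningful for \<open>n\<close> and \<open>m\<close> in \<open>normalisers B\<close>.\<close>

definition nle :: "'a::ring set \<Rightarrow> 'a \<Rightarrow> 'a \<Rightarrow> bool" where
  "nle B n m \<longleftrightarrow> n = n * dagger B n * m"

definition free_normalisers :: "'a::ring set \<Rightarrow> 'a set" where
  "free_normalisers B =
     {n \<in> normalisers B. n \<in> B \<or> (dagger B n * n) * (n * dagger B n) = 0}"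


section \<open>Algebraic pairs\<close>

definition cond_expectation :: "('r \<Rightarrow> 'a \<Rightarrow> 'a) \<Rightarrow> 'a::ring set \<Rightarrow> ('a \<Rightarrow> 'a) \<Rightarrow> bool" where
  "cond_expectation smul B P \<longleftrightarrow> range P \<subseteq> B \<and>
     (\<forall>a b. P (a + b) = P a + P b) \<and> (\<forall>t a. P (smul t a) = smul t (P a)) \<and>
     (\<forall>b\<in>B. P b = b) \<and>
     (\<forall>a. \<forall>b\<in>B. \<forall>b'\<in>B. P (b * a * b') = b * P a * b')"

definition faithful :: "'a::ring set \<Rightarrow> ('a \<Rightarrow> 'a) \<Rightarrow> bool" where
  "faithful B P \<longleftrightarrow> (\<forall>a. a \<noteq> 0 \<longrightarrow> (\<exists>n\<in>normalisers B. P (n * a) \<noteq> 0))"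

definition implemented_by_idems :: "'a::ring set \<Rightarrow> ('a \<Rightarrow> 'a) \<Rightarrow> bool" where
  "implemented_by_idems B P \<longleftrightarrow>
     (\<forall>n\<in>normalisers B. \<exists>e\<in>idems B. P n = n * e \<and> n * e = e * n)"

definition base_pair :: "('r::{comm_ring,comm_monoid_mult} \<Rightarrow> 'a \<Rightarrow> 'a) \<Rightarrow> 'a::ring set \<Rightarrow> bool" where
  "base_pair smul B \<longleftrightarrow> comm_subalgebra smul B \<and>
     (\<forall>t. \<forall>e\<in>idems B - {0}. smul t e = 0 \<longrightarrow> t = 0) \<and>
     local_units (idems B) \<and>
     B = lin_span smul (idems B) \<and>
     UNIV = lin_span smul (normalisers B) \<and>
     (\<exists>P. cond_expectation smul B P \<and> faithful B P)"

definition alg_diagonal_pair ::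
    "('r::{comm_ring,comm_monoid_mult} \<Rightarrow> 'a \<Rightarrow> 'a) \<Rightarrow> 'a::ring set \<Rightarrow> bool" where
  "alg_diagonal_pair smul B \<longleftrightarrow> base_pair smul B \<and> UNIV = lin_span smul (free_normalisers B)"

definition alg_Cartan_pair ::
    "('r::{comm_ring,comm_monoid_mult} \<Rightarrow> 'a \<Rightarrow> 'a) \<Rightarrow> 'a::ring set \<Rightarrow> bool" where
  "alg_Cartan_pair smul B \<longleftrightarrow> base_pair smul B \<and> maximal_comm_subalgebra smul B"

definition alg_quasi_Cartan_pair ::
    "('r::{comm_ring,comm_monoid_mult} \<Rightarrow> 'a \<Rightarrow> 'a) \<Rightarrow> 'a::ring set \<Rightarrow> bool" where
  "alg_quasi_Cartan_pair smul B \<longleftrightarrow> base_pair smul B \<and>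
     (\<exists>P. cond_expectation smul B P \<and> faithful B P \<and> implemented_by_idems B P)"


section \<open>Groupoids with a topology\<close>

text \<open>Only the data are recorded. The values of \<open>gmult\<close> are meaningful on \<open>composable\<close> pairs.\<close>

record 'g top_groupoid =
  arrows :: "'g set"
  composable :: "('g \<times> 'g) set"
  gmult :: "'g \<Rightarrow> 'g \<Rightarrow> 'g"
  ginv :: "'g \<Rightarrow> 'g"
  unit_space :: "'g set"
  gtop :: "'g topology"

definition gsrc :: "'g top_groupoid \<Rightarrow> 'g \<Rightarrow> 'g" where
  "gsrc G g = gmult G (ginv G g) g"

definition grng :: "'g top_groupoid \<Rightarrow> 'g \<Rightarrow> 'g" where
  "grng G g = gmult G g (ginv G g)"

definition isotropy :: "'g top_groupoid \<Rightarrow> 'g set" where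
  "isotropy G = {g \<in> arrows G. grng G g = gsrc G g}"

definition principal_groupoid :: "'g top_groupoid \<Rightarrow> bool" where
  "principal_groupoid G \<longleftrightarrow> isotropy G = unit_space G"

definition effective_groupoid :: "'g top_groupoid \<Rightarrow> bool" where
  "effective_groupoid G \<longleftrightarrow> (gtop G) interior_of (isotropy G) = unit_space G"

definition quotient_top :: "'g topology \<Rightarrow> ('g \<Rightarrow> 'h) \<Rightarrow> 'h topology" where
  "quotient_top X q =
     topology (\<lambda>S. S \<subseteq> q ` topspace X \<and> openin X {x \<in> topspace X. q x \<in> S})"

lemma openin_quotient_top:
  "openin (quotient_top X q) S \<longleftrightarrow>
     S \<subseteq> q ` topspace X \<and> openin X {x \<in> topspace X. q x \<in> S}"
proof -
  have "openin X {x \<in> topspace X. q x \<in> S \<inter> T}"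
    if "openin X {x \<in> topspace X. q x \<in> S}" "openin X {x \<in> topspace X. q x \<in> T}" for S T
  proof -
    have "{x \<in> topspace X. q x \<in> S \<inter> T} =
        {x \<in> topspace X. q x \<in> S} \<inter> {x \<in> topspace X. q x \<in> T}" by auto
    with that show ?thesis by (simp add: openin_Int)
  qed
  moreover have "openin X {x \<in> topspace X. q x \<in> \<Union>K}"
    if "\<forall>S\<in>K. openin X {x \<in> topspace X. q x \<in> S}" for K
  proof -
    have "{x \<in> topspace X. q x \<in> \<Union>K} = (\<Union>S\<in>K. {x \<in> topspace X. q x \<in> S})" by auto
    with that show ?thesis by auto
  qed
  ultimately have "istopology (\<lambda>S. S \<subseteq> q ` topspace X \<and> openin X {x \<in> topspace X. q x \<in> S})"
    unfolding istopology_def by (meson Sup_least le_infI1)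
  then show ?thesis
    unfolding quotient_top_def by (simp add: topology_inverse')
qed

lemma topspace_quotient_top: "topspace (quotient_top X q) = q ` topspace X"
proof
  show "topspace (quotient_top X q) \<subseteq> q ` topspace X"
    using openin_topspace[of "quotient_top X q"] unfolding openin_quotient_top by (rule conjunct1)
  have "{x \<in> topspace X. q x \<in> q ` topspace X} = topspace X" by auto
  then have "openin (quotient_top X q) (q ` topspace X)"
    by (simp add: openin_quotient_top)
  then show "q ` topspace X \<subseteq> topspace (quotient_top X q)"
    by (rule openin_subset)
qed

lemma quotient_map_quotient_top: "quotient_map X (quotient_top X q) q"
  unfolding quotient_map_def by (auto simp: topspace_quotient_top openin_quotient_top)

text \<open>
  The quotient of a groupoid by an equivalence relation on its arrows; a product or inverse in the
  quotient is the unique class obtained from (composable) representatives.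
\<close>

definition quotient_groupoid :: "'g top_groupoid \<Rightarrow> ('g \<times> 'g) set \<Rightarrow> 'g set top_groupoid" where
  "quotient_groupoid S R =
     \<lparr> arrows = arrows S // R,
       composable = {(R `` {U}, R `` {W}) | U W. (U, W) \<in> composable S},
       gmult = (\<lambda>g h. THE k. \<exists>U W. (U, W) \<in> composable S \<and>
                  g = R `` {U} \<and> h = R `` {W} \<and> k = R `` {gmult S U W}),
       ginv = (\<lambda>g. THE k. \<exists>U\<in>arrows S. g = R `` {U} \<and> k = R `` {ginv S U}),
       unit_space = (\<lambda>U. R `` {U}) ` unit_space S,
       gtop = quotient_top (gtop S) (\<lambda>U. R `` {U}) \<rparr>"


section \<open>The groupoids of ultrafilters\<close>

definition up_closure :: "'a::ring set \<Rightarrow> 'a set \<Rightarrow> 'a set" where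
  "up_closure B U = {m \<in> normalisers B. \<exists>n\<in>U. nle B n m}"

definition nfilter :: "'a::ring set \<Rightarrow> 'a set \<Rightarrow> bool" where
  "nfilter B U \<longleftrightarrow> U \<subseteq> normalisers B - {0} \<and> U = up_closure B U \<and>
     (\<forall>m\<in>U. \<forall>n\<in>U. \<exists>l\<in>U. nle B l m \<and> nle B l n)"

definition ultrafilters :: "'a::ring set \<Rightarrow> 'a set set" where
  "ultrafilters B =
     {U. nfilter B U \<and> U \<noteq> {} \<and> (\<forall>V. nfilter B V \<and> U \<subseteq> V \<longrightarrow> V = U)}"

definition ultra_basic :: "'a::ring set \<Rightarrow> 'a \<Rightarrow> 'a set set" where
  "ultra_basic B n = {U \<in> ultrafilters B. n \<in> U}"

text \<open>
  As the sets \<open>ultra_basic B n\<close> form a basis, the topology with that basis is the one they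
  generate; it is nonetheless a topology without appeal to the basis property.
\<close>

definition Sigma_groupoid :: "'a::ring set \<Rightarrow> 'a set top_groupoid" where
  "Sigma_groupoid B =
     \<lparr> arrows = ultrafilters B,
       composable = {(U, V). U \<in> ultrafilters B \<and> V \<in> ultrafilters B \<and>
                       (\<forall>m\<in>U. \<forall>n\<in>V. m * n \<noteq> 0)},
       gmult = (\<lambda>U V. up_closure B {m * n | m n. m \<in> U \<and> n \<in> V}),
       ginv = (\<lambda>U. dagger B ` U),
       unit_space = {U \<in> ultrafilters B. U \<inter> idems B \<noteq> {}},
       gtop = topology_generated_by (ultra_basic B ` normalisers B) \<rparr>"

definition scalar_equiv ::
    "('r::{comm_ring,comm_monoid_mult} \<Rightarrow> 'a \<Rightarrow> 'a) \<Rightarrow> 'a::ring set \<Rightarrow> ('a set \<times> 'a set) set" where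
  "scalar_equiv smul B = {(U, W). U \<in> ultrafilters B \<and> W \<in> ultrafilters B \<and>
     (\<exists>t\<in>scalar_units. U = smul t ` W)}"

definition G_groupoid ::
    "('r::{comm_ring,comm_monoid_mult} \<Rightarrow> 'a \<Rightarrow> 'a) \<Rightarrow> 'a::ring set \<Rightarrow> 'a set set top_groupoid" where
  "G_groupoid smul B = quotient_groupoid (Sigma_groupoid B) (scalar_equiv smul B)"

end

theory Submission
  imports Defs
begin

text \<open>
  An arrow of \<open>\<Sigma>\<close> is the germ of a normaliser \<open>n\<close> at an ultrafilter \<open>F\<close> of idempotents containing
  \<open>n\<dagger> n\<close>: the normalisers that lie above \<open>n f\<close> for some \<open>f \<in> F\<close> (\<open>nfilter_eq_germ\<close>, \<open>germ_ultra\<close>).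
  Source and range of the arrow correspond to ultrafilters of idempotents, \<open>src U\<close> and \<open>rng U\<close>.
  The class of \<open>U\<close> in \<open>G\<close> lies in the isotropy when \<open>src U = rng U\<close>, and it is a unit when \<open>U\<close>
  contains a scalar multiple \<open>t e\<close> of an idempotent by a unit \<open>t\<close>; call \<open>U\<close> a scalar germ in that
  case. So \<open>G\<close> is principal when every isotropic ultrafilter is a scalar germ, and, as the
  topology has the sets of germs of a single normaliser as a basis, \<open>G\<close> is effective when every
  normaliser with only isotropic germs has only scalar germs (\<open>principal_iff\<close>, \<open>effective_iff\<close>).

  These conditions translate into algebra. A normaliser has only isotropic germs when it
  commutes with the idempotents, hence with \<open>B\<close> (\<open>isotropic_iff_commutes\<close>), and it has only scalar
  germs when it lies in \<open>B\<close> (\<open>scalar_germ_if_in_B\<close>, \<open>in_B_if_scalar_germs\<close>). Thus \<open>G\<close> is effective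
  when all normalisers in the commutant of \<open>B\<close> lie in \<open>B\<close>. If \<open>B\<close> is maximal commutative, this
  holds. For the converse, suppose that \<open>a\<close> commutes with \<open>B\<close> and \<open>a' = a - P a \<noteq> 0\<close>.
  Faithfulness gives a normaliser \<open>n\<close> with \<open>P (n a') \<noteq> 0\<close>. As \<open>a'\<close> commutes with the idempotents,
  \<open>n\<close> has to fix every point at which \<open>P (n a')\<close> does not vanish; so for a small idempotent \<open>e\<close> all
  germs of \<open>n e\<close> are isotropic. Then \<open>n e \<in> B\<close>, and \<open>P (n a') e = P (n e a') = n e P a' = 0\<close>,
  although \<open>e\<close> was chosen inside the support of \<open>P (n a')\<close>.

  For principality, observe that a normaliser \<open>n\<close> whose germ at \<open>F\<close> is not isotropic becomes free
  when it is restricted to a small \<open>e \<in> F\<close>, since \<open>n\<close> moves \<open>F\<close> away from itself, while \<open>n e \<in> B\<close>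
  if the germ is scalar. Compactness then cuts every normaliser into finitely many free ones
  (\<open>principal_imp_spanned\<close>). Conversely, let the germ of \<open>n\<close> at \<open>F\<close> be isotropic and write \<open>n\<close> as
  a combination of free normalisers \<open>m\<close>. For small \<open>f \<in> F\<close> the terms \<open>f m f\<close> with \<open>m \<notin> B\<close> vanish,
  so \<open>f n f\<close>, which has the same germ as \<open>n\<close>, lies in \<open>B\<close> and the germ is scalar
  (\<open>spanned_imp_principal\<close>).
\<close>

section \<open>Linear combinations\<close>

context ring_algebra
begin

lemma smul_zero_left [simp]: "smul 0 a = 0"
  using smul_add_left[of 0 0 a] by simp

lemma smul_zero_right [simp]: "smul t 0 = 0"
  using smul_add_right[of t 0 0] by simp

lemma smul_minus_one: "smul (- 1) a = - a"
proof -
  have "smul (- 1) a + a = smul (- 1 + 1) a"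
    by (simp only: smul_add_left smul_one)
  then show ?thesis by (simp add: eq_neg_iff_add_eq_0)
qed

lemma smul_diff_left: "smul (s - t) a = smul s a - smul t a"
  using smul_add_left[of "s - t" t a] by (simp add: algebra_simps)

lemma smul_sum_right: "smul t (sum f S) = (\<Sum>x\<in>S. smul t (f x))"
  by (induction S rule: infinite_finite_induct) (auto simp: smul_add_right)

lemma smul_sum_left: "smul (sum c S) a = (\<Sum>x\<in>S. smul (c x) a)"
  by (induction S rule: infinite_finite_induct) (auto simp: smul_add_left)

lemma lin_span_base: "a \<in> S \<Longrightarrow> a \<in> lin_span smul S"
  unfolding lin_span_def
  by (rule CollectI, rule exI[of _ "{a}"], rule exI[of _ "\<lambda>_. 1"]) (simp add: smul_one)

lemma lin_span_zero: "0 \<in> lin_span smul S"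
  unfolding lin_span_def by (rule CollectI, rule exI[of _ "{}"]) simp

lemma lin_span_add:
  assumes "a \<in> lin_span smul S" "b \<in> lin_span smul S"
  shows "a + b \<in> lin_span smul S"
proof -
  obtain F c where F: "finite F" "F \<subseteq> S" "a = (\<Sum>x\<in>F. smul (c x) x)"
    using assms(1) unfolding lin_span_def by blast
  obtain G d where G: "finite G" "G \<subseteq> S" "b = (\<Sum>x\<in>G. smul (d x) x)"
    using assms(2) unfolding lin_span_def by blast
  let ?c = "\<lambda>x. if x \<in> F then c x else 0" and ?d = "\<lambda>x. if x \<in> G then d x else 0"
  have "a = (\<Sum>x\<in>F \<union> G. smul (?c x) x)"
    unfolding F(3) by (rule sum.mono_neutral_cong_left) (use F G in auto)
  moreover have "b = (\<Sum>x\<in>F \<union> G. smul (?d x) x)"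
    unfolding G(3) by (rule sum.mono_neutral_cong_left) (use F G in auto)
  ultimately have "a + b = (\<Sum>x\<in>F \<union> G. smul (?c x + ?d x) x)"
    by (simp only: smul_add_left sum.distrib)
  then show ?thesis
    unfolding lin_span_def using F(1,2) G(1,2)
    by (intro CollectI exI[of _ "F \<union> G"] exI[of _ "\<lambda>x. ?c x + ?d x"]) simp
qed

lemma lin_span_smul:
  assumes "a \<in> lin_span smul S"
  shows "smul t a \<in> lin_span smul S"
proof -
  obtain F c where F: "finite F" "F \<subseteq> S" "a = (\<Sum>x\<in>F. smul (c x) x)"
    using assms unfolding lin_span_def by blast
  then have "smul t a = (\<Sum>x\<in>F. smul (t * c x) x)"
    by (simp only: smul_sum_right smul_smul)
  then show ?thesis
    unfolding lin_span_def using F(1,2)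
    by (intro CollectI exI[of _ F] exI[of _ "\<lambda>x. t * c x"]) simp
qed

lemma lin_span_sum:
  assumes "\<And>x. x \<in> F \<Longrightarrow> f x \<in> lin_span smul S"
  shows "(\<Sum>x\<in>F. f x) \<in> lin_span smul S"
  using assms
  by (induction F rule: infinite_finite_induct) (auto intro: lin_span_zero lin_span_add)

lemma lin_span_diff:
  assumes "a \<in> lin_span smul S" "b \<in> lin_span smul S"
  shows "a - b \<in> lin_span smul S"
  using lin_span_add[OF assms(1) lin_span_smul[OF assms(2), of "- 1"]]
  by (simp add: smul_minus_one)

lemma lin_span_closed_right:
  assumes "a \<in> lin_span smul S" "\<And>x. x \<in> S \<Longrightarrow> x * b \<in> lin_span smul S"
  shows "a * b \<in> lin_span smul S"
proof -
  obtain F c where F: "finite F" "F \<subseteq> S" "a = (\<Sum>x\<in>F. smul (c x) x)"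
    using assms(1) unfolding lin_span_def by blast
  then have "a * b = (\<Sum>x\<in>F. smul (c x) (x * b))"
    by (simp add: sum_distrib_right smul_mult_left)
  also have "\<dots> \<in> lin_span smul S"
    by (rule lin_span_sum, rule lin_span_smul, rule assms(2)) (use F(2) in blast)
  finally show ?thesis .
qed

end


section \<open>The inverse semigroup of normalisers\<close>

locale local_unit_subalgebra = ring_algebra smul
  for smul :: "'r::{comm_ring,comm_monoid_mult} \<Rightarrow> 'a::ring \<Rightarrow> 'a" +
  fixes B :: "'a set"
  assumes comm_subalgebra_B: "comm_subalgebra smul B"
    and local_units_B: "local_units (idems B)"
begin

abbreviation "E \<equiv> idems B"
abbreviation "N \<equiv> normalisers B"
abbreviation dag ("_\<dagger>" [1000] 1000) where "n\<dagger> \<equiv> dagger B n"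
abbreviation le (infix "\<preceq>" 50) where "n \<preceq> m \<equiv> nle B n m"

lemma B_zero: "0 \<in> B"
  and B_add: "a \<in> B \<Longrightarrow> b \<in> B \<Longrightarrow> a + b \<in> B"
  and B_mult: "a \<in> B \<Longrightarrow> b \<in> B \<Longrightarrow> a * b \<in> B"
  and B_smul: "a \<in> B \<Longrightarrow> smul t a \<in> B"
  and B_comm: "a \<in> B \<Longrightarrow> b \<in> B \<Longrightarrow> a * b = b * a"
  using comm_subalgebra_B unfolding comm_subalgebra_def subalgebra_def by blast+

lemma B_diff: "a \<in> B \<Longrightarrow> b \<in> B \<Longrightarrow> a - b \<in> B"
  using B_add[of a "smul (- 1) b"] B_smul[of b "- 1"] by (simp add: smul_minus_one)

lemma B_sum: "(\<And>x. x \<in> S \<Longrightarrow> f x \<in> B) \<Longrightarrow> (\<Sum>x\<in>S. f x) \<in> B"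
  by (induction S rule: infinite_finite_induct) (auto intro: B_zero B_add)

lemma E_B: "e \<in> E \<Longrightarrow> e \<in> B"
  and E_idem: "e \<in> E \<Longrightarrow> e * e = e"
  unfolding idems_def by auto

lemma E_comm: "e \<in> E \<Longrightarrow> f \<in> E \<Longrightarrow> e * f = f * e"
  by (simp add: B_comm E_B)

lemma E_comm_left: "e \<in> E \<Longrightarrow> f \<in> E \<Longrightarrow> e * (f * x) = f * (e * x)"
  by (metis E_comm mult.assoc)

lemma E_absorb: "e \<in> E \<Longrightarrow> e * (e * x) = e * x"
  by (metis E_idem mult.assoc)

lemma E_zero: "0 \<in> E"
  by (simp add: idems_def B_zero)

lemma E_mult: "e \<in> E \<Longrightarrow> f \<in> E \<Longrightarrow> e * f \<in> E"
  unfolding idems_def by (auto simp: B_mult) (metis B_comm mult.assoc)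

lemma E_diff: "e \<in> E \<Longrightarrow> f \<in> E \<Longrightarrow> e - e * f \<in> E"
  using E_mult[of e f] E_comm[of e f]
  unfolding idems_def
  by (auto simp: B_diff algebra_simps) (metis mult.assoc)+

lemma E_join: "e \<in> E \<Longrightarrow> f \<in> E \<Longrightarrow> e + f - e * f \<in> E"
proof -
  assume ef: "e \<in> E" "f \<in> E"
  have "(e + f - e * f) * (e + f - e * f) = e + f - e * f"
    using ef by (simp add: algebra_simps E_idem E_comm E_comm_left E_absorb)
  with ef show ?thesis unfolding idems_def by (auto simp: B_add B_diff B_mult)
qed

lemma common_unit:
  assumes "finite S"
  obtains e where "e \<in> E" "\<And>a. a \<in> S \<Longrightarrow> e * a = a" "\<And>a. a \<in> S \<Longrightarrow> a * e = a"
  using local_units_B assms unfolding local_units_def by metis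

lemma normaliser_inverse_sym: "normaliser_inverse B n k \<Longrightarrow> normaliser_inverse B k n"
  unfolding normaliser_inverse_def by auto

lemma normaliser_inverse_idem:
  assumes "normaliser_inverse B n k"
  shows "n * k \<in> E"
proof -
  obtain e where e: "e \<in> E" "n * e = n"
    using common_unit[of "{n}"] by auto
  have "n * e * k \<in> B"
    using assms E_B[OF e(1)] unfolding normaliser_inverse_def by blast
  then have "n * k \<in> B" by (simp add: e)
  moreover have "(n * k) * (n * k) = n * k"
    using assms unfolding normaliser_inverse_def by (metis mult.assoc)
  ultimately show ?thesis by (simp add: idems_def)
qed

text \<open>Generalised inverses are unique because the idempotents they give rise to commute.\<close>

lemma normaliser_inverse_unique:
  assumes k: "normaliser_inverse B n k" and l: "normaliser_inverse B n l"
  shows "k = l"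
proof -
  have eqs: "k * n * k = k" "n * k * n = n" "l * n * l = l" "n * l * n = n"
    using k l unfolding normaliser_inverse_def by blast+
  have "n * k \<in> E" "n * l \<in> E" "k * n \<in> E" "l * n \<in> E"
    using k l normaliser_inverse_idem normaliser_inverse_sym by blast+
  note comm = E_comm[OF this(1,2)] E_comm[OF this(3,4)]
  have "k = k * (n * l * n) * k" by (simp add: eqs)
  also have "\<dots> = k * ((n * l) * (n * k))" by (simp add: mult.assoc)
  also have "\<dots> = (k * n * k) * n * l" unfolding comm(1)[symmetric] by (simp add: mult.assoc)
  also have "\<dots> = k * n * l" by (simp add: eqs)
  finally have 1: "k = k * n * l" .
  have "l = l * (n * k * n) * l" by (simp add: eqs)
  also have "\<dots> = ((l * n) * (k * n)) * l" by (simp add: mult.assoc)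
  also have "\<dots> = k * (n * l * n) * l" unfolding comm(2)[symmetric] by (simp add: mult.assoc)
  also have "\<dots> = k * n * l" by (simp add: eqs)
  finally show ?thesis using 1 by simp
qed

lemma dagger_eqI: "normaliser_inverse B n k \<Longrightarrow> n\<dagger> = k"
  unfolding dagger_def by (rule the_equality) (auto intro: normaliser_inverse_unique)

lemma N_I: "normaliser_inverse B n k \<Longrightarrow> n \<in> N"
  unfolding normalisers_def by blast

lemma dagger_inverse: "n \<in> N \<Longrightarrow> normaliser_inverse B n (n\<dagger>)"
  unfolding normalisers_def using dagger_eqI by auto

lemma N_dagger: "n \<in> N \<Longrightarrow> n\<dagger> \<in> N"
  and dagger_dagger: "n \<in> N \<Longrightarrow> n\<dagger>\<dagger> = n"
  and N_conj: "n \<in> N \<Longrightarrow> b \<in> B \<Longrightarrow> n * (b * n\<dagger>) \<in> B"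
  and N_conj': "n \<in> N \<Longrightarrow> b \<in> B \<Longrightarrow> n\<dagger> * (b * n) \<in> B"
  and N_dagger_mult: "n \<in> N \<Longrightarrow> n\<dagger> * n \<in> E"
  and N_mult_dagger: "n \<in> N \<Longrightarrow> n * n\<dagger> \<in> E"
proof -
  assume "n \<in> N"
  note inv = dagger_inverse[OF this] and inv' = normaliser_inverse_sym[OF dagger_inverse[OF this]]
  show "n\<dagger> \<in> N" "n\<dagger>\<dagger> = n" "n\<dagger> * n \<in> E" "n * n\<dagger> \<in> E"
    using N_I[OF inv'] dagger_eqI[OF inv'] normaliser_inverse_idem[OF inv]
      normaliser_inverse_idem[OF inv'] by simp_all
  show "n * (b * n\<dagger>) \<in> B" "n\<dagger> * (b * n) \<in> B" if "b \<in> B"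
    using inv that unfolding normaliser_inverse_def mult.assoc by blast+
qed

lemma inv_simps:
  assumes "n \<in> N"
  shows "n * (n\<dagger> * n) = n" "n * (n\<dagger> * (n * x)) = n * x"
    "n\<dagger> * (n * n\<dagger>) = n\<dagger>" "n\<dagger> * (n * (n\<dagger> * x)) = n\<dagger> * x"
  using dagger_inverse[OF assms] unfolding normaliser_inverse_def
  by (simp_all add: mult.assoc) (metis mult.assoc)+

lemma E_inverse: "e \<in> E \<Longrightarrow> normaliser_inverse B e e"
  unfolding normaliser_inverse_def by (simp add: E_idem B_mult E_B)

lemma E_N: "e \<in> E \<Longrightarrow> e \<in> N" and E_dagger: "e \<in> E \<Longrightarrow> e\<dagger> = e"
  using E_inverse N_I dagger_eqI by blast+

lemma E_conj:
  assumes n: "n \<in> N" and e: "e \<in> E"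
  shows "n * (e * n\<dagger>) \<in> E"
proof -
  have "(n * (e * n\<dagger>)) * (n * (e * n\<dagger>)) = n * (e * ((n\<dagger> * n) * (e * n\<dagger>)))"
    by (simp add: mult.assoc)
  also have "\<dots> = n * (e * n\<dagger>)"
    unfolding E_comm_left[OF N_dagger_mult[OF n] e]
    by (simp add: E_absorb[OF e] mult.assoc inv_simps[OF n])
  finally show ?thesis
    using N_conj[OF n E_B[OF e]] by (simp add: idems_def)
qed

lemma E_conj': "n \<in> N \<Longrightarrow> e \<in> E \<Longrightarrow> n\<dagger> * (e * n) \<in> E"
  using E_conj[OF N_dagger] by (simp add: dagger_dagger)

text \<open>
  Idempotents pass through a normaliser at the price of conjugation. This makes the order
  accessible from both sides and is the algebraic form of the action of \<open>n\<close> on ultrafilters of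
  idempotents.
\<close>

lemma move_left:
  assumes n: "n \<in> N" and e: "e \<in> E"
  shows "n * e = (n * (e * n\<dagger>)) * n"
proof -
  have "n * e = n * ((n\<dagger> * n) * e)" by (simp add: mult.assoc inv_simps[OF n])
  also have "\<dots> = (n * (e * n\<dagger>)) * n"
    unfolding E_comm[OF N_dagger_mult[OF n] e] by (simp add: mult.assoc)
  finally show ?thesis .
qed

lemma move_right:
  assumes n: "n \<in> N" and e: "e \<in> E"
  shows "e * n = n * (n\<dagger> * (e * n))"
proof -
  have "e * n = e * ((n * n\<dagger>) * n)" by (simp add: mult.assoc inv_simps[OF n])
  also have "\<dots> = n * (n\<dagger> * (e * n))"
    unfolding E_comm_left[OF e N_mult_dagger[OF n]] by (simp add: mult.assoc)
  finally show ?thesis .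
qed

text \<open>
  The generalised inverses compose because \<open>m\<dagger> m\<close> and \<open>n n\<dagger>\<close> commute.
\<close>

lemma mult_inverse:
  assumes m: "m \<in> N" and n: "n \<in> N"
  shows "normaliser_inverse B (m * n) (n\<dagger> * m\<dagger>)"
proof -
  have c: "m\<dagger> * (m * (n * (n\<dagger> * x))) = n * (n\<dagger> * (m\<dagger> * (m * x)))" for x
    using E_comm_left[OF N_dagger_mult[OF m] N_mult_dagger[OF n], of x] by (simp add: mult.assoc)
  have "n\<dagger> * (m\<dagger> * (m * (n * (n\<dagger> * m\<dagger>)))) = n\<dagger> * m\<dagger>"
    unfolding c by (simp add: inv_simps[OF n] inv_simps[OF m])
  moreover have "m * (n * (n\<dagger> * (m\<dagger> * (m * n)))) = m * n"
    unfolding c[symmetric] by (simp add: inv_simps[OF n] inv_simps[OF m])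
  moreover have "n\<dagger> * (m\<dagger> * (b * (m * n))) \<in> B" if "b \<in> B" for b
    using N_conj'[OF n N_conj'[OF m that]] by (simp add: mult.assoc)
  moreover have "m * (n * (b * (n\<dagger> * m\<dagger>))) \<in> B" if "b \<in> B" for b
    using N_conj[OF m N_conj[OF n that]] by (simp add: mult.assoc)
  ultimately show ?thesis
    unfolding normaliser_inverse_def by (simp add: mult.assoc)
qed

lemma N_mult: "m \<in> N \<Longrightarrow> n \<in> N \<Longrightarrow> m * n \<in> N"
  and dagger_mult: "m \<in> N \<Longrightarrow> n \<in> N \<Longrightarrow> (m * n)\<dagger> = n\<dagger> * m\<dagger>"
  using mult_inverse N_I dagger_eqI by blast+

lemma N_zero: "0 \<in> N"
  by (rule E_N[OF E_zero])

lemma dagger_zero: "0\<dagger> = 0"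
  by (rule E_dagger[OF E_zero])

lemma N_mult_E: "n \<in> N \<Longrightarrow> e \<in> E \<Longrightarrow> n * e \<in> N"
  and N_E_mult: "n \<in> N \<Longrightarrow> e \<in> E \<Longrightarrow> e * n \<in> N"
  by (auto intro: N_mult E_N)

lemma smul_inverse:
  assumes "n \<in> N" "t * s = 1"
  shows "normaliser_inverse B (smul t n) (smul s (n\<dagger>))"
proof -
  have st: "s * t = 1" using assms(2) by (simp add: mult.commute)
  have [simp]: "smul t (smul s a) = a" "smul s (smul t a) = a" for a
    by (simp_all add: smul_smul assms(2) st smul_one)
  show ?thesis
    unfolding normaliser_inverse_def
    by (simp add: smul_mult_left smul_mult_right mult.assoc inv_simps[OF assms(1)]
      N_conj[OF assms(1)] N_conj'[OF assms(1)])
qed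

lemma scalar_unitsE:
  assumes "t \<in> scalar_units"
  obtains s where "s \<in> scalar_units" "t * s = 1" "s * t = 1"
  using assms unfolding scalar_units_def by (auto elim!: dvdE) (metis dvd_triv_left mult.commute)

lemma N_smul: "n \<in> N \<Longrightarrow> t \<in> scalar_units \<Longrightarrow> smul t n \<in> N"
  and dagger_smul: "n \<in> N \<Longrightarrow> t * s = 1 \<Longrightarrow> (smul t n)\<dagger> = smul s (n\<dagger>)"
  using smul_inverse N_I dagger_eqI scalar_unitsE by metis+

lemma nle_iff_left:
  assumes n: "n \<in> N" and m: "m \<in> N"
  shows "n \<preceq> m \<longleftrightarrow> (\<exists>e\<in>E. n = e * m)"
proof
  assume "n \<preceq> m"
  then show "\<exists>e\<in>E. n = e * m" unfolding nle_def using N_mult_dagger[OF n] by auto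
next
  assume "\<exists>e\<in>E. n = e * m"
  then obtain e where e: "e \<in> E" "n = e * m" by blast
  have "n * n\<dagger> * m = e * ((m * m\<dagger>) * (e * m))"
    by (simp add: e dagger_mult[OF E_N[OF e(1)] m] E_dagger mult.assoc)
  also have "\<dots> = n"
    unfolding E_comm_left[OF N_mult_dagger[OF m] e(1)]
    by (simp add: e(2) E_absorb[OF e(1)] mult.assoc inv_simps[OF m])
  finally show "n \<preceq> m" unfolding nle_def by simp
qed

lemma nle_iff_right:
  assumes n: "n \<in> N" and m: "m \<in> N"
  shows "n \<preceq> m \<longleftrightarrow> (\<exists>e\<in>E. n = m * e)"
  unfolding nle_iff_left[OF n m]
  using move_left[OF m] move_right[OF m] E_conj[OF m] E_conj'[OF m] by metis

lemma nle_mult_E: "m \<in> N \<Longrightarrow> e \<in> E \<Longrightarrow> m * e \<preceq> m"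
  using nle_iff_right N_mult_E by blast

lemma nle_E_mult: "m \<in> N \<Longrightarrow> e \<in> E \<Longrightarrow> e * m \<preceq> m"
  using nle_iff_left N_E_mult by blast

lemma nle_refl: "m \<in> N \<Longrightarrow> m \<preceq> m"
  unfolding nle_def by (simp add: inv_simps mult.assoc)

lemma nle_trans:
  assumes N: "l \<in> N" "m \<in> N" "n \<in> N" and le: "l \<preceq> m" "m \<preceq> n"
  shows "l \<preceq> n"
proof -
  obtain e f where ef: "e \<in> E" "f \<in> E" "l = e * m" "m = f * n"
    using le N by (auto simp: nle_iff_left)
  then have "l = (e * f) * n" by (simp add: mult.assoc)
  then show ?thesis using N E_mult[OF ef(1,2)] by (auto simp: nle_iff_left)
qed

lemma nle_dagger:
  assumes N: "m \<in> N" "n \<in> N" and le: "m \<preceq> n"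
  shows "m\<dagger> \<preceq> n\<dagger>"
proof -
  obtain e where e: "e \<in> E" "m = e * n" using le N by (auto simp: nle_iff_left)
  then have "m\<dagger> = n\<dagger> * e" by (simp add: dagger_mult E_N N E_dagger)
  with e(1) nle_mult_E N_dagger[OF N(2)] show ?thesis by simp
qed

lemma nle_smul:
  assumes N: "m \<in> N" "n \<in> N" and t: "t \<in> scalar_units" and le: "m \<preceq> n"
  shows "smul t m \<preceq> smul t n"
proof -
  obtain e where e: "e \<in> E" "m = e * n" using le N by (auto simp: nle_iff_left)
  then have "smul t m = e * smul t n" by (simp add: smul_mult_right)
  with e(1) nle_E_mult N_smul[OF N(2) t] show ?thesis by simp
qed

lemma nle_eq_restrict:
  assumes N: "m \<in> N" "n \<in> N" and le: "m \<preceq> n"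
  shows "m = n * (m\<dagger> * m)"
proof -
  obtain e where e: "e \<in> E" "m = n * e" using le N by (auto simp: nle_iff_right)
  have "n * (m\<dagger> * m) = n * (e * ((n\<dagger> * n) * e))"
    by (simp add: e dagger_mult E_N N E_dagger mult.assoc)
  also have "\<dots> = m"
    unfolding E_comm_left[OF e(1) N_dagger_mult[OF N(2)]]
    by (simp add: e(2) E_idem[OF e(1)] mult.assoc inv_simps[OF N(2)])
  finally show ?thesis by simp
qed

text \<open>A common lower bound of two normalisers is what makes \<open>u\<dagger> v\<close> lie above an idempotent.\<close>

lemma nle_dagger_mult:
  assumes N: "w \<in> N" "u \<in> N" "v \<in> N" and le: "w \<preceq> u" "w \<preceq> v"
  shows "w\<dagger> * w \<preceq> u\<dagger> * v"
proof -
  obtain e where e: "e \<in> E" "w\<dagger> = e * u\<dagger>"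
    using nle_dagger[OF N(1,2) le(1)] N by (auto simp: nle_iff_left N_dagger)
  obtain f where f: "f \<in> E" "w = v * f" using le(2) N by (auto simp: nle_iff_right)
  have uv: "u\<dagger> * v \<in> N" by (simp add: N N_mult N_dagger)
  have "w\<dagger> * w = e * ((u\<dagger> * v) * f)" using e f by (metis mult.assoc)
  moreover have "e * ((u\<dagger> * v) * f) \<preceq> (u\<dagger> * v) * f"
    by (rule nle_E_mult) (simp_all add: uv e f N_mult_E)
  moreover have "(u\<dagger> * v) * f \<preceq> u\<dagger> * v" by (rule nle_mult_E[OF uv f(1)])
  ultimately show ?thesis
    by (metis nle_trans uv N_mult_E N_E_mult e(1) f(1))
qed

end


section \<open>Ultrafilters of normalisers as germs\<close>

context local_unit_subalgebra
begin

definition idem_filter :: "'a set \<Rightarrow> bool" where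
  "idem_filter F \<longleftrightarrow> F \<subseteq> E \<and> F \<noteq> {} \<and> 0 \<notin> F \<and> (\<forall>e\<in>F. \<forall>f\<in>F. e * f \<in> F) \<and>
     (\<forall>e\<in>F. \<forall>f\<in>E. e * f = e \<longrightarrow> f \<in> F)"

text \<open>
  Maximality of a filter is expressed by complements: any idempotent outside \<open>F\<close> is annihilated by
  a member of \<open>F\<close>. In a generalised Boolean algebra this is equivalent to maximality, and it is the
  form in which points are separated below.
\<close>

definition idem_ultrafilter :: "'a set \<Rightarrow> bool" where
  "idem_ultrafilter F \<longleftrightarrow> idem_filter F \<and> (\<forall>e\<in>E. e \<notin> F \<longrightarrow> (\<exists>f\<in>F. e * f = 0))"

definition idem_ideal :: "'a set \<Rightarrow> bool" where
  "idem_ideal J \<longleftrightarrow> J \<subseteq> E \<and> 0 \<in> J \<and> (\<forall>j\<in>J. \<forall>e\<in>E. j * e \<in> J) \<and>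
     (\<forall>i\<in>J. \<forall>j\<in>J. i + j - i * j \<in> J)"

lemma idem_filter_E: "idem_filter F \<Longrightarrow> f \<in> F \<Longrightarrow> f \<in> E"
  and idem_filter_nonzero: "idem_filter F \<Longrightarrow> f \<in> F \<Longrightarrow> f \<noteq> 0"
  and idem_filter_mult: "idem_filter F \<Longrightarrow> e \<in> F \<Longrightarrow> f \<in> F \<Longrightarrow> e * f \<in> F"
  and idem_filter_up: "idem_filter F \<Longrightarrow> e \<in> F \<Longrightarrow> f \<in> E \<Longrightarrow> e * f = e \<Longrightarrow> f \<in> F"
  unfolding idem_filter_def by blast+

lemma idem_filter_factor:
  assumes "idem_filter F" "e * f \<in> F" "e \<in> E" "f \<in> E"
  shows "e \<in> F" "f \<in> F"
  by (rule idem_filter_up[OF assms(1,2)];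
    simp add: assms E_comm E_comm_left E_absorb E_idem mult.assoc)+

text \<open>
  Finitely many conditions that hold eventually along a filter hold simultaneously. This is how
  finite linear combinations are localised at a point.
\<close>

lemma idem_filter_common:
  assumes F: "idem_filter F" and fin: "finite S" and ex: "\<And>x. x \<in> S \<Longrightarrow> \<exists>f\<in>F. Q x f"
    and down: "\<And>x f g. x \<in> S \<Longrightarrow> Q x f \<Longrightarrow> f \<in> F \<Longrightarrow> g \<in> F \<Longrightarrow> Q x (f * g)"
  shows "\<exists>f\<in>F. \<forall>x\<in>S. Q x f"
  using fin ex down
proof (induction S)
  case empty
  then show ?case using F unfolding idem_filter_def by blast
next
  case (insert x S)
  obtain f where f: "f \<in> F" "\<forall>y\<in>S. Q y f" using insert by blast
  obtain g where g: "g \<in> F" "Q x g" using insert.prems by blast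
  have "g * f = f * g" by (rule E_comm) (use idem_filter_E[OF F] f g in auto)
  then have "\<forall>y\<in>insert x S. Q y (f * g)"
    using f g insert.prems(2) by (metis insert_iff)
  then show ?case using idem_filter_mult[OF F f(1) g(1)] by blast
qed

lemma idem_ultrafilter_idem_filter: "idem_ultrafilter F \<Longrightarrow> idem_filter F"
  unfolding idem_ultrafilter_def by blast

lemma idem_ultrafilter_disjoint: "idem_ultrafilter F \<Longrightarrow> e \<in> E \<Longrightarrow> e \<notin> F \<Longrightarrow> \<exists>f\<in>F. e * f = 0"
  unfolding idem_ultrafilter_def by blast

lemma idem_ultrafilter_maximal:
  assumes F: "idem_ultrafilter F" and G: "idem_filter G" and sub: "F \<subseteq> G"
  shows "G = F"
proof -
  have "g \<in> F" if g: "g \<in> G" for g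
    using idem_ultrafilter_disjoint[OF F idem_filter_E[OF G g]] idem_filter_mult[OF G g] idem_filter_nonzero[OF G] sub
    by fastforce
  with sub show ?thesis by blast
qed

text \<open>
  The prime ideal theorem for the generalised Boolean algebra of idempotents, relative to \<open>e\<close>
  because there is no largest idempotent: with \<open>M\<close> an ideal that is maximal among those avoiding
  \<open>e\<close>, the ultrafilter consists of the \<open>f\<close> with \<open>e - e f \<in> M\<close>.
\<close>

lemma idem_ultrafilter_avoiding_ideal:
  assumes J: "idem_ideal J" and e: "e \<in> E" "e \<notin> J"
  obtains F where "idem_ultrafilter F" "e \<in> F" "F \<inter> J = {}"
proof -
  let ?A = "{I. idem_ideal I \<and> J \<subseteq> I \<and> e \<notin> I}"
  note simps = algebra_simps E_idem E_comm E_comm_left E_absorb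
  have "\<exists>M\<in>?A. \<forall>X\<in>?A. M \<subseteq> X \<longrightarrow> X = M"
  proof (rule subset_Zorn_nonempty)
    show "?A \<noteq> {}" using assms by blast
    fix C assume C: "C \<noteq> {}" "subset.chain ?A C"
    have id: "idem_ideal I" "J \<subseteq> I" "e \<notin> I" if "I \<in> C" for I
      using C(2) that unfolding subset.chain_def by blast+
    have "i + j - i * j \<in> \<Union>C" if ij: "i \<in> I1" "I1 \<in> C" "j \<in> I2" "I2 \<in> C" for i j I1 I2
    proof -
      obtain I where "I \<in> C" "i \<in> I" "j \<in> I"
        using C(2) ij unfolding subset.chain_def by blast
      with id(1)[of I] show ?thesis unfolding idem_ideal_def by blast
    qed
    moreover have "j * x \<in> \<Union>C" if "j \<in> \<Union>C" "x \<in> E" for j x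
      using id(1) that unfolding idem_ideal_def by blast
    moreover have "\<Union>C \<subseteq> E" "0 \<in> \<Union>C"
      using id(1) C(1) unfolding idem_ideal_def by blast+
    ultimately have "idem_ideal (\<Union>C)"
      unfolding idem_ideal_def by (meson UnionE)
    with id(2,3) C(1) show "\<Union>C \<in> ?A" by blast
  qed
  then obtain M where M: "idem_ideal M" "J \<subseteq> M" "e \<notin> M"
    and max: "\<And>X. idem_ideal X \<Longrightarrow> J \<subseteq> X \<Longrightarrow> e \<notin> X \<Longrightarrow> M \<subseteq> X \<Longrightarrow> X = M"
    by auto
  have ME: "\<And>x. x \<in> M \<Longrightarrow> x \<in> E" and M0: "0 \<in> M"
    and Mm: "\<And>x y. x \<in> M \<Longrightarrow> y \<in> E \<Longrightarrow> x * y \<in> M"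
    and Mj: "\<And>x y. x \<in> M \<Longrightarrow> y \<in> M \<Longrightarrow> x + y - x * y \<in> M"
    using M(1) unfolding idem_ideal_def by blast+
  have dichotomy: "e - e * f \<in> M" if f: "f \<in> E" "e * f \<notin> M" for f
  proof -
    let ?g = "e * f"
    \<comment> \<open>the ideal generated by \<open>M\<close> and \<open>g\<close>, as the \<open>x\<close> whose part outside \<open>g\<close> lies in \<open>M\<close>\<close>
    let ?I = "{x \<in> E. x - x * ?g \<in> M}"
    have g: "?g \<in> E" by (simp add: E_mult e f)
    have "x * y - (x * y) * ?g \<in> M" if "x \<in> ?I" "y \<in> E" for x y
    proof -
      have "x * y - (x * y) * ?g = (x - x * ?g) * y"
        using that g e f by (simp add: simps)
      also have "\<dots> \<in> M" by (rule Mm) (use that in auto)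
      finally show ?thesis .
    qed
    moreover have "(x + y - x * y) - (x + y - x * y) * ?g \<in> M" if "x \<in> ?I" "y \<in> ?I" for x y
    proof -
      have "(x + y - x * y) - (x + y - x * y) * ?g
          = (x - x * ?g) + (y - y * ?g) - (x - x * ?g) * (y - y * ?g)"
        using that e f by (simp add: simps)
      also have "\<dots> \<in> M" by (rule Mj) (use that in auto)
      finally show ?thesis .
    qed
    ultimately have "idem_ideal ?I"
      unfolding idem_ideal_def using M0 by (auto intro: E_zero E_mult E_join)
    moreover have MI: "M \<subseteq> ?I"
    proof
      fix m assume m: "m \<in> M"
      have "m - m * ?g = m * (m - m * ?g)" using ME[OF m] e f by (simp add: simps)
      also have "\<dots> \<in> M" by (intro Mm m E_diff ME g)
      finally show "m \<in> ?I" using ME[OF m] by simp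
    qed
    moreover have "?I \<noteq> M"
    proof -
      have "?g - ?g * ?g = 0" using e f by (simp add: simps)
      then have "?g \<in> ?I" using g M0 by simp
      with f show ?thesis by metis
    qed
    ultimately have "e \<in> ?I" using max M(2) by blast
    moreover have "e - e * ?g = e - e * f" using e f by (simp add: simps)
    ultimately show ?thesis by simp
  qed
  define F where "F = {f \<in> E. e - e * f \<in> M}"
  have "idem_filter F"
    unfolding idem_filter_def
  proof (intro conjI ballI impI)
    show "F \<subseteq> E" "0 \<notin> F" using M(3) unfolding F_def by auto
    have "e \<in> F" using e M0 by (simp add: F_def E_idem)
    then show "F \<noteq> {}" by blast
    show "f * f' \<in> F" if "f \<in> F" "f' \<in> F" for f f'
    proof -
      have "e - e * (f * f') = (e - e * f) + (e - e * f') - (e - e * f) * (e - e * f')"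
        using that e unfolding F_def by (simp add: simps)
      also have "\<dots> \<in> M" by (rule Mj) (use that in \<open>auto simp: F_def\<close>)
      finally show ?thesis using that unfolding F_def by (simp add: E_mult)
    qed
    show "f' \<in> F" if "f \<in> F" "f' \<in> E" "f * f' = f" for f f'
    proof -
      have "(e - e * f) * (e - e * f') = e - e * f' - e * f + e * (f * f')"
        using that e unfolding F_def by (simp add: simps)
      then have "e - e * f' = (e - e * f) * (e - e * f')" by (simp add: that)
      also have "\<dots> \<in> M"
        by (rule Mm) (use that E_diff[OF e(1) that(2)] in \<open>auto simp: F_def\<close>)
      finally show ?thesis using that unfolding F_def by simp
    qed
  qed
  moreover have "\<exists>f'\<in>F. f * f' = 0" if f: "f \<in> E" "f \<notin> F" for f
  proof
    have "e * f \<in> M" using f dichotomy[of f] unfolding F_def by blast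
    moreover have "e - e * (e - e * f) = e * f" using e f by (simp add: simps)
    ultimately show "e - e * f \<in> F"
      unfolding F_def using E_diff[OF e(1) f(1)] by simp
    show "f * (e - e * f) = 0" using e f by (simp add: simps)
  qed
  ultimately have "idem_ultrafilter F" unfolding idem_ultrafilter_def by blast
  moreover have "e \<in> F" using e M0 by (simp add: F_def E_idem)
  moreover have "F \<inter> J = {}"
  proof -
    have False if f: "f \<in> F" "f \<in> J" for f
    proof -
      have fE: "f \<in> E" and 1: "e - e * f \<in> M" using f(1) unfolding F_def by auto
      have 2: "f * e \<in> M" using Mm f(2) M(2) e(1) by blast
      have "(e - e * f) + f * e - (e - e * f) * (f * e) = e"
        using e fE by (simp add: simps)
      with Mj[OF 1 2] M(3) show False by simp
    qed
    then show ?thesis by blast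
  qed
  ultimately show ?thesis by (rule that)
qed

text \<open>
  Compactness of the set of ultrafilters containing \<open>e\<close>, in the shape used for passing from a property
  that holds locally at each ultrafilter to one that holds on \<open>e\<close>: the idempotents with the
  property form an ideal.
\<close>

lemma idem_ideal_compact:
  assumes "idem_ideal J" "e \<in> E" "\<And>F. idem_ultrafilter F \<Longrightarrow> e \<in> F \<Longrightarrow> F \<inter> J \<noteq> {}"
  shows "e \<in> J"
  using idem_ultrafilter_avoiding_ideal assms by metis

lemma idem_ultrafilter_exists:
  assumes "e \<in> E" "e \<noteq> 0"
  obtains F where "idem_ultrafilter F" "e \<in> F"
proof -
  have "idem_ideal {0}" by (simp add: idem_ideal_def E_zero)
  from idem_ultrafilter_avoiding_ideal[OF this, of e] assms that show ?thesis by blast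
qed

text \<open>
  The idempotents lying above \<open>u\<dagger> u\<close> for some \<open>u \<in> U\<close>. The source of the arrow \<open>U\<close> is the
  up-closure of this set among the normalisers (\<open>up_closure_dagger_product\<close>).
\<close>

definition src :: "'a set \<Rightarrow> 'a set" where
  "src U = {e \<in> E. \<exists>u\<in>U. u * e = u}"

definition rng :: "'a set \<Rightarrow> 'a set" where
  "rng U = {e \<in> E. \<exists>u\<in>U. e * u = u}"

definition germ :: "'a \<Rightarrow> 'a set \<Rightarrow> 'a set" where
  "germ n F = {m \<in> N. \<exists>f\<in>F. n * f \<preceq> m}"

lemma nfilter_N: "nfilter B U \<Longrightarrow> u \<in> U \<Longrightarrow> u \<in> N"
  and nfilter_nonzero: "nfilter B U \<Longrightarrow> u \<in> U \<Longrightarrow> u \<noteq> 0"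
  unfolding nfilter_def by blast+

lemma nfilter_up: "nfilter B U \<Longrightarrow> u \<in> U \<Longrightarrow> m \<in> N \<Longrightarrow> u \<preceq> m \<Longrightarrow> m \<in> U"
  unfolding nfilter_def up_closure_def by blast

lemma nfilter_down:
  assumes "nfilter B U" "u \<in> U" "v \<in> U"
  obtains w where "w \<in> U" "w \<preceq> u" "w \<preceq> v"
  using assms unfolding nfilter_def by blast

lemma nfilterI:
  assumes "\<And>u. u \<in> U \<Longrightarrow> u \<in> N" "0 \<notin> U"
    and "\<And>u m. u \<in> U \<Longrightarrow> m \<in> N \<Longrightarrow> u \<preceq> m \<Longrightarrow> m \<in> U"
    and "\<And>u v. u \<in> U \<Longrightarrow> v \<in> U \<Longrightarrow> \<exists>w\<in>U. w \<preceq> u \<and> w \<preceq> v"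
  shows "nfilter B U"
  using assms nle_refl unfolding nfilter_def up_closure_def by blast

lemma ultra_nfilter: "U \<in> ultrafilters B \<Longrightarrow> nfilter B U"
  and ultra_nonempty: "U \<in> ultrafilters B \<Longrightarrow> U \<noteq> {}"
  and ultra_maximal: "U \<in> ultrafilters B \<Longrightarrow> nfilter B V \<Longrightarrow> U \<subseteq> V \<Longrightarrow> V = U"
  unfolding ultrafilters_def by blast+

lemma ultra_N: "U \<in> ultrafilters B \<Longrightarrow> u \<in> U \<Longrightarrow> u \<in> N"
  by (rule nfilter_N[OF ultra_nfilter])

lemma nfilter_mult_src:
  assumes U: "nfilter B U" and n: "n \<in> U" and e: "e \<in> src U"
  shows "n * e \<in> U"
proof -
  obtain u where u: "u \<in> U" "u * e = u" and eE: "e \<in> E" using e unfolding src_def by blast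
  obtain w where w: "w \<in> U" "w \<preceq> n" "w \<preceq> u" using nfilter_down[OF U n u(1)] .
  note N = nfilter_N[OF U n] nfilter_N[OF U u(1)] nfilter_N[OF U w(1)]
  obtain h where h: "h \<in> E" "w = n * h" using w(2) N by (auto simp: nle_iff_right)
  obtain f where f: "f \<in> E" "w = f * u" using w(3) N by (auto simp: nle_iff_left)
  have "w = w * e" using f u by (simp add: mult.assoc)
  also have "\<dots> = (n * e) * h" using h eE by (simp add: mult.assoc E_comm)
  finally have "w \<preceq> n * e"
    using h(1) nle_iff_right N N_mult_E eE by blast
  then show ?thesis using nfilter_up[OF U w(1)] N_mult_E N(1) eE by blast
qed

lemma src_dagger_mult:
  assumes U: "nfilter B U" and w: "w \<in> U"
  shows "w\<dagger> * w \<in> src U"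
  using w inv_simps(1)[OF nfilter_N[OF U w]] N_dagger_mult[OF nfilter_N[OF U w]]
  unfolding src_def by blast

lemma src_idem_filter:
  assumes U: "nfilter B U" and ne: "U \<noteq> {}"
  shows "idem_filter (src U)"
  unfolding idem_filter_def
proof (intro conjI ballI impI)
  show "src U \<subseteq> E" unfolding src_def by blast
  show "src U \<noteq> {}" using src_dagger_mult[OF U] ne by blast
  show "0 \<notin> src U" unfolding src_def using nfilter_nonzero[OF U] by auto
  show "e * f \<in> src U" if e: "e \<in> src U" and f: "f \<in> src U" for e f
  proof -
    have ef: "e \<in> E" "f \<in> E" using e f unfolding src_def by auto
    obtain n where "n \<in> U" using ne by blast
    then have "(n * e) * f \<in> U" by (intro nfilter_mult_src[OF U] e f)
    moreover have "((n * e) * f) * (e * f) = (n * e) * f"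
      using ef by (simp add: mult.assoc E_comm E_comm_left E_idem E_absorb)
    ultimately show ?thesis unfolding src_def using E_mult[OF ef] by blast
  qed
  show "f \<in> src U" if "e \<in> src U" "f \<in> E" "e * f = e" for e f
    using that unfolding src_def by (auto simp: mult.assoc) (metis mult.assoc)
qed

text \<open>
  A filter is determined by any one of its members and its source, since a common lower bound of
  \<open>n\<close> and \<open>u\<close> is a restriction of \<open>n\<close> to an idempotent of the source.
\<close>

lemma nfilter_eq_germ:
  assumes U: "nfilter B U" and n: "n \<in> U"
  shows "U = germ n (src U)"
proof
  show "U \<subseteq> germ n (src U)"
  proof
    fix u assume u: "u \<in> U"
    obtain w where w: "w \<in> U" "w \<preceq> n" "w \<preceq> u" using nfilter_down[OF U n u] .
    have "w = n * (w\<dagger> * w)" by (rule nle_eq_restrict) (use nfilter_N[OF U] w n in auto)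
    then show "u \<in> germ n (src U)"
      unfolding germ_def using src_dagger_mult[OF U w(1)] w(3) nfilter_N[OF U u] by force
  qed
  show "germ n (src U) \<subseteq> U"
    unfolding germ_def using nfilter_mult_src[OF U n] nfilter_up[OF U] by blast
qed

lemma germ_nfilter:
  assumes F: "idem_filter F" and n: "n \<in> N" and nz: "\<And>f. f \<in> F \<Longrightarrow> n * f \<noteq> 0"
  shows "nfilter B (germ n F)"
proof (rule nfilterI)
  have nf: "n * f \<in> N" if "f \<in> F" for f using N_mult_E[OF n] idem_filter_E[OF F that] .
  show "u \<in> N" if "u \<in> germ n F" for u using that unfolding germ_def by blast
  show "0 \<notin> germ n F"
    using nz nle_iff_left[OF nf N_zero] unfolding germ_def by auto
  show "m \<in> germ n F" if "u \<in> germ n F" "m \<in> N" "u \<preceq> m" for u m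
    using that nle_trans nf unfolding germ_def by blast
  show "\<exists>w\<in>germ n F. w \<preceq> u \<and> w \<preceq> v" if germs: "u \<in> germ n F" "v \<in> germ n F" for u v
  proof -
    obtain f g where fg: "f \<in> F" "n * f \<preceq> u" "g \<in> F" "n * g \<preceq> v" and uv: "u \<in> N" "v \<in> N"
      using germs unfolding germ_def by blast
    have E: "f \<in> E" "g \<in> E" using fg idem_filter_E[OF F] by auto
    have fgF: "f * g \<in> F" using idem_filter_mult[OF F] fg by blast
    have "n * (f * g) = (n * f) * g" "n * (f * g) = (n * g) * f"
      by (simp_all add: mult.assoc E_comm[OF E])
    then have "n * (f * g) \<preceq> n * f" "n * (f * g) \<preceq> n * g"
      using nle_mult_E nf fg(1,3) E by metis+
    then have "n * (f * g) \<preceq> u" "n * (f * g) \<preceq> v"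
      using nle_trans nf fgF fg uv by blast+
    moreover have "n * (f * g) \<in> germ n F"
      unfolding germ_def using nf[OF fgF] fgF nle_refl by blast
    ultimately show ?thesis by blast
  qed
qed

text \<open>
  If \<open>src U\<close> were not maximal, the larger filter of idempotents would give a germ of the same
  normaliser that is a strictly larger filter than \<open>U\<close>.
\<close>

lemma src_ultra:
  assumes U: "U \<in> ultrafilters B"
  shows "idem_ultrafilter (src U)"
  unfolding idem_ultrafilter_def
proof (intro conjI ballI impI)
  note nf = ultra_nfilter[OF U]
  show F: "idem_filter (src U)" by (rule src_idem_filter[OF nf ultra_nonempty[OF U]])
  obtain n where n: "n \<in> U" using ultra_nonempty[OF U] by blast
  have nN: "n \<in> N" using nfilter_N[OF nf n] .
  fix e assume e: "e \<in> E" "e \<notin> src U"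
  show "\<exists>f\<in>src U. e * f = 0"
  proof (rule ccontr)
    assume "\<not> ?thesis"
    then have nz: "\<And>f. f \<in> src U \<Longrightarrow> e * f \<noteq> 0" by blast
    \<comment> \<open>the filter generated by \<open>src U\<close> and \<open>e\<close>\<close>
    define G where "G = {g \<in> E. \<exists>f\<in>src U. (e * f) * g = e * f}"
    have sub: "src U \<subseteq> G"
    proof
      fix f assume f: "f \<in> src U"
      have "(e * f) * f = e * f" using idem_filter_E[OF F f] by (simp add: mult.assoc E_idem)
      then show "f \<in> G" unfolding G_def using f idem_filter_E[OF F f] by blast
    qed
    have eG: "e \<in> G"
    proof -
      obtain f where f: "f \<in> src U" using src_dagger_mult[OF nf n] by blast
      have "(e * f) * e = e * f"
        using idem_filter_E[OF F f] e(1) by (simp add: mult.assoc E_comm E_absorb)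
      then show ?thesis unfolding G_def using f e(1) by blast
    qed
    have G: "idem_filter G"
      unfolding idem_filter_def
    proof (intro conjI ballI impI)
      show "G \<subseteq> E" "G \<noteq> {}" "0 \<notin> G" using eG nz unfolding G_def by auto
      show "x * y \<in> G" if xy: "x \<in> G" "y \<in> G" for x y
      proof -
        obtain f g where fg: "f \<in> src U" "(e * f) * x = e * f" "g \<in> src U" "(e * g) * y = e * g"
          and E: "x \<in> E" "y \<in> E"
          using xy unfolding G_def by blast
        note E = E idem_filter_E[OF F fg(1)] idem_filter_E[OF F fg(3)]
        have "(e * (f * g)) * (x * y) = ((e * f) * x) * ((e * g) * y)"
          using E e(1) by (simp add: mult.assoc E_comm E_comm_left E_absorb)
        also have "\<dots> = e * (f * g)"
          unfolding fg(2,4) using E e(1) by (simp add: mult.assoc E_comm E_comm_left E_absorb)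
        finally show ?thesis
          unfolding G_def using idem_filter_mult[OF F fg(1,3)] E_mult[OF E(1,2)] by blast
      qed
      show "y \<in> G" if "x \<in> G" "y \<in> E" "x * y = x" for x y
        using that unfolding G_def by (auto simp: mult.assoc) (metis mult.assoc)
    qed
    have "n * g \<noteq> 0" if "g \<in> G" for g
    proof
      assume "n * g = 0"
      then have "(n\<dagger> * n) * g = 0" by (simp add: mult.assoc)
      moreover have "n\<dagger> * n \<in> G" using sub src_dagger_mult[OF nf n] by blast
      ultimately show False using idem_filter_mult[OF G] idem_filter_nonzero[OF G] that by metis
    qed
    then have V: "nfilter B (germ n G)" by (rule germ_nfilter[OF G nN])
    have "U \<subseteq> germ n G"
      using nfilter_eq_germ[OF nf n] sub unfolding germ_def by blast
    then have "germ n G = U" by (rule ultra_maximal[OF U V])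
    moreover have "n * e \<in> germ n G"
      unfolding germ_def using N_mult_E[OF nN e(1)] eG nle_refl by blast
    ultimately have "n * e \<in> U" by simp
    moreover have "(n * e) * e = n * e" using e(1) by (simp add: mult.assoc E_idem)
    ultimately have "e \<in> src U" unfolding src_def using e(1) by blast
    with e(2) show False by blast
  qed
qed

lemma germ_ultra:
  assumes F: "idem_ultrafilter F" and n: "n \<in> N" and nF: "n\<dagger> * n \<in> F"
  shows "germ n F \<in> ultrafilters B" "src (germ n F) = F" "n \<in> germ n F"
proof -
  note F' = idem_ultrafilter_idem_filter[OF F]
  have "n * f \<noteq> 0" if "f \<in> F" for f
  proof
    assume "n * f = 0"
    then have "(n\<dagger> * n) * f = 0" by (simp add: mult.assoc)
    then show False using idem_filter_mult[OF F' nF that] idem_filter_nonzero[OF F'] by metis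
  qed
  then have G: "nfilter B (germ n F)" by (rule germ_nfilter[OF F' n])
  have nf: "n * f \<in> germ n F" if "f \<in> F" for f
    unfolding germ_def using N_mult_E[OF n idem_filter_E[OF F' that]] nle_refl that by blast
  have "n * (n\<dagger> * n) = n" by (simp add: inv_simps[OF n])
  with nf[OF nF] show nG: "n \<in> germ n F" by simp
  have sub: "F \<subseteq> src (germ n F)"
  proof
    fix f assume f: "f \<in> F"
    have "(n * f) * f = n * f" using idem_filter_E[OF F' f] by (simp add: mult.assoc E_idem)
    then show "f \<in> src (germ n F)" unfolding src_def using nf[OF f] idem_filter_E[OF F' f] by blast
  qed
  have src: "src W = F" if W: "nfilter B W" "germ n F \<subseteq> W" for W
  proof (rule idem_ultrafilter_maximal[OF F])
    show "idem_filter (src W)" by (rule src_idem_filter) (use W nG in auto)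
    show "F \<subseteq> src W" using sub W(2) unfolding src_def by blast
  qed
  show "src (germ n F) = F" by (rule src[OF G]) simp
  show "germ n F \<in> ultrafilters B"
    unfolding ultrafilters_def
  proof (intro CollectI conjI allI impI G)
    show "germ n F \<noteq> {}" using nG by blast
    fix W assume W: "nfilter B W \<and> germ n F \<subseteq> W"
    then have "W = germ n (src W)" using nfilter_eq_germ nG by blast
    with src W show "W = germ n F" by simp
  qed
qed

text \<open>
  The dagger and the multiplications by a scalar unit are automorphisms of the ordered set of
  normalisers, and so permute the ultrafilters.
\<close>

lemma order_automorphism_ultra:
  assumes U: "U \<in> ultrafilters B"
    and N: "\<And>n. n \<in> N \<Longrightarrow> p n \<in> N" "\<And>n. n \<in> N \<Longrightarrow> p' n \<in> N"
    and inv: "\<And>n. n \<in> N \<Longrightarrow> p' (p n) = n" "\<And>n. n \<in> N \<Longrightarrow> p (p' n) = n"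
    and mono: "\<And>m n. m \<in> N \<Longrightarrow> n \<in> N \<Longrightarrow> m \<preceq> n \<Longrightarrow> p m \<preceq> p n"
      "\<And>m n. m \<in> N \<Longrightarrow> n \<in> N \<Longrightarrow> m \<preceq> n \<Longrightarrow> p' m \<preceq> p' n"
    and zero: "p 0 = 0" "p' 0 = 0"
  shows "p ` U \<in> ultrafilters B"
proof -
  have im: "nfilter B (q ` V)"
    if V: "nfilter B V" and N: "\<And>n. n \<in> N \<Longrightarrow> q n \<in> N" "\<And>n. n \<in> N \<Longrightarrow> q' n \<in> N"
      and inv: "\<And>n. n \<in> N \<Longrightarrow> q' (q n) = n" "\<And>n. n \<in> N \<Longrightarrow> q (q' n) = n"
      and mono: "\<And>m n. m \<in> N \<Longrightarrow> n \<in> N \<Longrightarrow> m \<preceq> n \<Longrightarrow> q m \<preceq> q n"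
        "\<And>m n. m \<in> N \<Longrightarrow> n \<in> N \<Longrightarrow> m \<preceq> n \<Longrightarrow> q' m \<preceq> q' n"
      and zero: "q' 0 = 0" for q q' V
  proof (rule nfilterI)
    show "u \<in> N" if "u \<in> q ` V" for u using that N nfilter_N[OF V] by blast
    show "0 \<notin> q ` V"
      using inv(1) zero nfilter_N[OF V] nfilter_nonzero[OF V] by (metis imageE)
    show "m \<in> q ` V" if m: "u \<in> q ` V" "m \<in> N" "u \<preceq> m" for u m
    proof -
      obtain v where v: "v \<in> V" "u = q v" using m(1) by blast
      have vN: "v \<in> N" using nfilter_N[OF V v(1)] .
      have "v \<preceq> q' m" using mono(2)[OF _ m(2,3)] inv(1)[OF vN] N(1)[OF vN] v(2) by simp
      then have "q' m \<in> V" using nfilter_up[OF V v(1)] N(2) m(2) by blast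
      then show ?thesis using inv(2)[OF m(2)] by force
    qed
    show "\<exists>w\<in>q ` V. w \<preceq> u \<and> w \<preceq> v" if uv: "u \<in> q ` V" "v \<in> q ` V" for u v
    proof -
      obtain a b where ab: "a \<in> V" "u = q a" "b \<in> V" "v = q b" using uv by blast
      obtain w where "w \<in> V" "w \<preceq> a" "w \<preceq> b" using nfilter_down[OF V ab(1,3)] .
      with ab mono(1) nfilter_N[OF V] show ?thesis by blast
    qed
  qed
  show ?thesis
    unfolding ultrafilters_def
  proof (intro CollectI conjI allI impI)
    show "nfilter B (p ` U)" by (rule im[OF ultra_nfilter[OF U] N inv mono zero(2)])
    show "p ` U \<noteq> {}" using ultra_nonempty[OF U] by blast
    fix V assume V: "nfilter B V \<and> p ` U \<subseteq> V"
    have "nfilter B (p' ` V)" by (rule im[OF conjunct1[OF V] N(2,1) inv(2,1) mono(2,1) zero(1)])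
    moreover have "U \<subseteq> p' ` V"
    proof
      fix u assume "u \<in> U"
      then have "p u \<in> V" "p' (p u) = u" using V inv(1) ultra_N[OF U] by blast+
      then show "u \<in> p' ` V" by force
    qed
    ultimately have "p' ` V = U" by (rule ultra_maximal[OF U])
    moreover have "p ` p' ` V = V"
      using V inv(2) nfilter_N unfolding image_image by (simp add: image_def) fastforce
    ultimately show "V = p ` U" by simp
  qed
qed

lemma dagger_ultra: "U \<in> ultrafilters B \<Longrightarrow> dagger B ` U \<in> ultrafilters B"
  by (rule order_automorphism_ultra[where p' = "dagger B"])
    (simp_all add: N_dagger dagger_dagger nle_dagger dagger_zero)

lemma smul_ultra:
  assumes "U \<in> ultrafilters B" "t \<in> scalar_units"
  shows "smul t ` U \<in> ultrafilters B"
proof -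
  obtain s where s: "s \<in> scalar_units" "t * s = 1" "s * t = 1" using scalar_unitsE[OF assms(2)] .
  show ?thesis
    by (rule order_automorphism_ultra[OF assms(1), where p' = "smul s"])
      (simp_all add: N_smul nle_smul s assms smul_smul smul_one)
qed

lemma rng_eq_src_dagger:
  assumes U: "U \<in> ultrafilters B"
  shows "rng U = src (dagger B ` U)"
proof -
  have "e * u = u \<longleftrightarrow> u\<dagger> * e = u\<dagger>" if "u \<in> U" "e \<in> E" for u e
  proof -
    have u: "u \<in> N" using ultra_N[OF U that(1)] .
    have 1: "(e * u)\<dagger> = u\<dagger> * e" by (simp add: dagger_mult E_N E_dagger u that)
    show ?thesis using 1 dagger_dagger[OF u] dagger_dagger[OF N_E_mult[OF u that(2)]] by metis
  qed
  then show ?thesis unfolding rng_def src_def by auto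
qed

lemma rng_ultra: "U \<in> ultrafilters B \<Longrightarrow> idem_ultrafilter (rng U)"
  by (simp add: rng_eq_src_dagger src_ultra dagger_ultra)

lemma ultra_mult_rng:
  assumes U: "U \<in> ultrafilters B" and n: "n \<in> U" and e: "e \<in> rng U"
  shows "e * n \<in> U"
proof -
  have eE: "e \<in> E" and nN: "n \<in> N" using e ultra_N[OF U n] unfolding rng_def by auto
  have "n\<dagger> * e \<in> dagger B ` U"
    using nfilter_mult_src[OF ultra_nfilter[OF dagger_ultra[OF U]]] n e
    unfolding rng_eq_src_dagger[OF U] by blast
  then obtain u where u: "u \<in> U" "n\<dagger> * e = u\<dagger>" by blast
  have "u = (n\<dagger> * e)\<dagger>" using u dagger_dagger ultra_N[OF U] by simp
  also have "\<dots> = e * n" by (simp add: dagger_mult N_dagger nN E_N eE E_dagger dagger_dagger)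
  finally show ?thesis using u by simp
qed

text \<open>
  A member \<open>n\<close> of \<open>U\<close> transports the source to the range: \<open>e\<close> holds at the range exactly if its
  pull-back \<open>n\<dagger> e n\<close> holds at the source.
\<close>

lemma rng_iff_conj:
  assumes U: "U \<in> ultrafilters B" and n: "n \<in> U" and e: "e \<in> E"
  shows "e \<in> rng U \<longleftrightarrow> n\<dagger> * (e * n) \<in> src U"
proof -
  have nN: "n \<in> N" using ultra_N[OF U n] .
  have k: "n\<dagger> * (e * n) \<in> E" by (rule E_conj'[OF nN e])
  have mv: "e * n = n * (n\<dagger> * (e * n))" by (rule move_right[OF nN e])
  show ?thesis
  proof
    assume "e \<in> rng U"
    then have "e * n \<in> U" by (rule ultra_mult_rng[OF U n])
    moreover have "(e * n) * (n\<dagger> * (e * n)) = e * n"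
      using mv e by (metis E_absorb mult.assoc)
    ultimately show "n\<dagger> * (e * n) \<in> src U" unfolding src_def using k by blast
  next
    assume "n\<dagger> * (e * n) \<in> src U"
    then have "e * n \<in> U"
      using nfilter_mult_src[OF ultra_nfilter[OF U] n] mv by metis
    then show "e \<in> rng U" unfolding rng_def using e E_absorb by blast
  qed
qed


lemma dagger_dagger_image: "U \<in> ultrafilters B \<Longrightarrow> dagger B ` dagger B ` U = U"
  using dagger_dagger ultra_N by (simp add: image_image)

lemma smul_inverse_image:
  assumes "t * s = 1"
  shows "smul t ` smul s ` U = U"
  by (simp add: image_image smul_smul smul_one assms)

definition product :: "'a set \<Rightarrow> 'a set \<Rightarrow> 'a set" where
  "product U W = {m * n | m n. m \<in> U \<and> n \<in> W}"

lemma up_closure_idem_ultrafilter: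
  assumes F: "idem_ultrafilter F"
  shows "up_closure B F \<in> ultrafilters B" "src (up_closure B F) = F"
proof -
  note F' = idem_ultrafilter_idem_filter[OF F]
  obtain f where f: "f \<in> F" using F' unfolding idem_filter_def by blast
  have fE: "f \<in> E" using idem_filter_E[OF F' f] .
  have "f * g \<in> F \<and> (\<forall>m\<in>N. g \<preceq> m \<longrightarrow> f * g \<preceq> m)" if g: "g \<in> F" for g
  proof -
    have "g \<in> E" using idem_filter_E[OF F' g] .
    with fE have "f * g \<in> N" "g \<in> N" "f * g \<preceq> g" by (simp_all add: E_N N_E_mult nle_E_mult)
    with nle_trans idem_filter_mult[OF F' f g] show ?thesis by blast
  qed
  then have eq: "up_closure B F = germ f F"
    unfolding up_closure_def germ_def by blast
  have "f\<dagger> * f \<in> F" using f fE by (simp add: E_dagger E_idem)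
  from germ_ultra[OF F E_N[OF fE] this]
  show "up_closure B F \<in> ultrafilters B" "src (up_closure B F) = F"
    unfolding eq by blast+
qed

text \<open>
  The groupoid product of \<open>U\<close> with its inverse, that is, the source of \<open>U\<close> in \<open>\<Sigma>\<close>.
\<close>

lemma up_closure_dagger_product:
  assumes U: "U \<in> ultrafilters B"
  shows "up_closure B (product (dagger B ` U) U) = up_closure B (src U)"
proof -
  note nf = ultra_nfilter[OF U]
  have "\<exists>e\<in>src U. e \<preceq> m" if m: "m \<in> N" "u \<in> U" "v \<in> U" "u\<dagger> * v \<preceq> m" for m u v
  proof -
    obtain w where w: "w \<in> U" "w \<preceq> u" "w \<preceq> v" using nfilter_down[OF nf m(2,3)] .
    note N = ultra_N[OF U m(2)] ultra_N[OF U m(3)] ultra_N[OF U w(1)]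
    have "w\<dagger> * w \<preceq> u\<dagger> * v" by (rule nle_dagger_mult[OF N(3,1,2) w(2,3)])
    with m(1,4) N have "w\<dagger> * w \<preceq> m" by (meson nle_trans N_mult N_dagger)
    with src_dagger_mult[OF nf w(1)] show ?thesis by blast
  qed
  moreover have "\<exists>u\<in>U. \<exists>v\<in>U. u\<dagger> * v \<preceq> m" if m: "m \<in> N" "e \<in> src U" "e \<preceq> m" for m e
  proof -
    obtain u where u: "u \<in> U" "u * e = u" and e: "e \<in> E" using m(2) unfolding src_def by blast
    have uN: "u \<in> N" using ultra_N[OF U u(1)] .
    have "u\<dagger> * u = e * (u\<dagger> * u)"
      unfolding E_comm[OF e N_dagger_mult[OF uN]] by (simp add: mult.assoc u)
    then have "u\<dagger> * u \<preceq> e" using nle_iff_left E_N e N_dagger_mult[OF uN] E_comm by metis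
    then have "u\<dagger> * u \<preceq> m" using nle_trans m E_N e N_dagger_mult[OF uN] by blast
    with u(1) show ?thesis by blast
  qed
  moreover have "m \<in> up_closure B (product (dagger B ` U) U) \<longleftrightarrow>
      m \<in> N \<and> (\<exists>u\<in>U. \<exists>v\<in>U. u\<dagger> * v \<preceq> m)" for m
    unfolding up_closure_def product_def by auto
  moreover have "m \<in> up_closure B (src U) \<longleftrightarrow> m \<in> N \<and> (\<exists>e\<in>src U. e \<preceq> m)" for m
    unfolding up_closure_def by blast
  ultimately show ?thesis by (intro set_eqI) metis
qed

lemma up_closure_product_dagger:
  assumes U: "U \<in> ultrafilters B"
  shows "up_closure B (product U (dagger B ` U)) = up_closure B (rng U)"
  using up_closure_dagger_product[OF dagger_ultra[OF U]]
  by (simp add: dagger_dagger_image U rng_eq_src_dagger)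

lemma composable_iff:
  "(U, W) \<in> composable (Sigma_groupoid B) \<longleftrightarrow>
     U \<in> ultrafilters B \<and> W \<in> ultrafilters B \<and> 0 \<notin> product U W"
  unfolding Sigma_groupoid_def product_def by auto

lemma composable_dagger:
  assumes U: "U \<in> ultrafilters B"
  shows "(dagger B ` U, U) \<in> composable (Sigma_groupoid B)"
proof -
  have "0 \<notin> product (dagger B ` U) U"
  proof
    assume "0 \<in> product (dagger B ` U) U"
    then have "0 \<in> up_closure B (product (dagger B ` U) U)"
      unfolding up_closure_def using N_zero nle_refl[OF N_zero] by blast
    then have "0 \<in> up_closure B (src U)" by (simp add: up_closure_dagger_product[OF U])
    with nfilter_nonzero[OF ultra_nfilter[OF up_closure_idem_ultrafilter(1)[OF src_ultra[OF U]]]]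
    show False by blast
  qed
  with U show ?thesis by (simp add: composable_iff dagger_ultra)
qed

lemma composable_dagger':
  assumes U: "U \<in> ultrafilters B"
  shows "(U, dagger B ` U) \<in> composable (Sigma_groupoid B)"
  using composable_dagger[OF dagger_ultra[OF U]] by (simp add: dagger_dagger_image U)

lemma up_closure_smul:
  assumes S: "S \<subseteq> N" and t: "t \<in> scalar_units"
  shows "up_closure B (smul t ` S) = smul t ` up_closure B S"
proof -
  obtain s where s: "s \<in> scalar_units" "t * s = 1" "s * t = 1" using scalar_unitsE[OF t] .
  have cancel: "smul s (smul t a) = a" "smul t (smul s a) = a" for a
    by (simp_all add: smul_smul smul_one s)
  have "m \<in> smul t ` up_closure B S" if m: "m \<in> N" "n \<in> S" "smul t n \<preceq> m" for m n
  proof -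
    have n: "n \<in> N" using m(2) S by blast
    have "n \<preceq> smul s m"
      using nle_smul[OF N_smul[OF n t] m(1) s(1) m(3)] cancel by simp
    then have "smul s m \<in> up_closure B S"
      unfolding up_closure_def using N_smul[OF m(1) s(1)] m(2) by blast
    then show ?thesis using cancel(2)[of m] by force
  qed
  moreover have "smul t m \<in> up_closure B (smul t ` S)" if "m \<in> up_closure B S" for m
    using that nle_smul[OF _ _ t] N_smul[OF _ t] S unfolding up_closure_def by blast
  ultimately show ?thesis unfolding up_closure_def by blast
qed

lemma product_smul:
  "product (smul t ` U) (smul s ` W) = smul (t * s) ` product U W"
proof -
  have eq: "smul t m * smul s n = smul (t * s) (m * n)" for m n
    by (simp add: smul_mult_left smul_mult_right smul_smul mult.commute[of s t])
  have "product U W = (\<lambda>(m, n). m * n) ` (U \<times> W)" for U W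
    unfolding product_def by auto
  moreover have "smul t ` U \<times> smul s ` W = map_prod (smul t) (smul s) ` (U \<times> W)"
    by (rule map_prod_surj_on[OF refl refl, symmetric])
  ultimately show ?thesis by (simp add: image_image split_def eq)
qed

lemma scalar_units_mult:
  "s \<in> scalar_units \<Longrightarrow> t \<in> scalar_units \<Longrightarrow> s * t \<in> scalar_units"
  unfolding scalar_units_def using mult_dvd_mono[of s 1 t 1] by simp

lemma scalar_units_one: "1 \<in> scalar_units"
  unfolding scalar_units_def by simp

end


section \<open>The quotient groupoid\<close>

text \<open>
  One faithful conditional expectation is fixed. The map is part of the data here, while the
  notion of a pair only asserts that it exists.
\<close>

locale algebraic_pair = local_unit_subalgebra smul B
  for smul :: "'r::{comm_ring,comm_monoid_mult} \<Rightarrow> 'a::ring \<Rightarrow> 'a" and B :: "'a set" +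
  fixes P :: "'a \<Rightarrow> 'a"
  assumes torsion_free: "e \<in> E \<Longrightarrow> e \<noteq> 0 \<Longrightarrow> smul t e = 0 \<Longrightarrow> t = 0"
    and B_span: "B = lin_span smul E"
    and A_span: "UNIV = lin_span smul N"
    and expectation: "cond_expectation smul B P"
    and faithful_P: "faithful B P"
begin

abbreviation "G \<equiv> G_groupoid smul B"
abbreviation "cls U \<equiv> scalar_equiv smul B `` {U}"

lemma equiv_scalar_equiv: "equiv (ultrafilters B) (scalar_equiv smul B)"
proof (rule equivI)
  show "scalar_equiv smul B \<subseteq> ultrafilters B \<times> ultrafilters B"
    unfolding scalar_equiv_def by blast
  show "refl_on (ultrafilters B) (scalar_equiv smul B)"
    unfolding scalar_equiv_def refl_on_def
    by (auto intro!: bexI[OF _ scalar_units_one] simp: smul_one)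
  show "sym (scalar_equiv smul B)"
  proof (rule symI)
    fix U W assume "(U, W) \<in> scalar_equiv smul B"
    then obtain t where UW: "U \<in> ultrafilters B" "W \<in> ultrafilters B" "U = smul t ` W"
      and t: "t \<in> scalar_units"
      unfolding scalar_equiv_def by blast
    obtain s where s: "s \<in> scalar_units" "s * t = 1" using scalar_unitsE[OF t] .
    have "W = smul s ` U" unfolding UW(3) by (simp add: smul_inverse_image[OF s(2)])
    with UW s(1) show "(W, U) \<in> scalar_equiv smul B" unfolding scalar_equiv_def by blast
  qed
  show "trans (scalar_equiv smul B)"
  proof (rule transI)
    fix U V W assume "(U, V) \<in> scalar_equiv smul B" "(V, W) \<in> scalar_equiv smul B"
    then obtain s t where "U \<in> ultrafilters B" "W \<in> ultrafilters B"
        "s \<in> scalar_units" "t \<in> scalar_units" "U = smul s ` smul t ` W"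
      unfolding scalar_equiv_def by blast
    moreover from this have "U = smul (s * t) ` W" by (simp add: image_image smul_smul)
    ultimately show "(U, W) \<in> scalar_equiv smul B"
      unfolding scalar_equiv_def using scalar_units_mult by blast
  qed
qed

lemma cls_eq_iff:
  assumes "U \<in> ultrafilters B" "W \<in> ultrafilters B"
  shows "cls U = cls W \<longleftrightarrow> (\<exists>t\<in>scalar_units. U = smul t ` W)"
  using eq_equiv_class_iff[OF equiv_scalar_equiv assms] assms
  unfolding scalar_equiv_def by simp

lemma cls_smul:
  assumes "U \<in> ultrafilters B" "t \<in> scalar_units"
  shows "cls (smul t ` U) = cls U"
  unfolding cls_eq_iff[OF smul_ultra[OF assms] assms(1)] using assms(2) by blast

lemma ginv_cls:
  assumes U: "U \<in> ultrafilters B"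
  shows "ginv G (cls U) = cls (dagger B ` U)"
proof -
  have "cls (dagger B ` W) = cls (dagger B ` U)"
    if W: "W \<in> ultrafilters B" and eq: "cls U = cls W" for W
  proof -
    obtain t where t: "t \<in> scalar_units" "U = smul t ` W"
      using eq unfolding cls_eq_iff[OF U W] by blast
    obtain s where s: "s \<in> scalar_units" "t * s = 1" "s * t = 1" using scalar_unitsE[OF t(1)] .
    have "dagger B ` U = smul s ` dagger B ` W"
      unfolding t(2) using ultra_N[OF W] dagger_smul[OF _ s(2)] by (simp add: image_image)
    then show ?thesis by (simp only: cls_smul[OF dagger_ultra[OF W] s(1)])
  qed
  then have "(THE k. \<exists>W\<in>ultrafilters B. cls U = cls W \<and> k = cls (dagger B ` W)) = cls (dagger B ` U)"
    by (intro the_equality bexI[OF _ U] conjI refl) (elim bexE conjE, simp only:)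
  then show ?thesis
    unfolding G_groupoid_def quotient_groupoid_def Sigma_groupoid_def by (simp only: top_groupoid.simps)
qed

text \<open>
  Changing the representatives by units \<open>t\<close> and \<open>s\<close> changes the product by \<open>t s\<close>, so that the
  definite description in the product of classes is met by a single class.
\<close>

lemma gmult_cls:
  assumes comp: "(U, W) \<in> composable (Sigma_groupoid B)"
    and prod: "up_closure B (product U W) \<in> ultrafilters B"
  shows "gmult G (cls U) (cls W) = cls (up_closure B (product U W))"
proof -
  have U: "U \<in> ultrafilters B" "W \<in> ultrafilters B" using comp by (simp_all add: composable_iff)
  have uniq: "cls (up_closure B (product U' W')) = cls (up_closure B (product U W))"
    if comp': "(U', W') \<in> composable (Sigma_groupoid B)"
      and eq: "cls U = cls U'" "cls W = cls W'" for U' W'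
  proof -
    have U': "U' \<in> ultrafilters B" "W' \<in> ultrafilters B"
      using comp' by (simp_all add: composable_iff)
    obtain t s where ts: "t \<in> scalar_units" "U' = smul t ` U" "s \<in> scalar_units" "W' = smul s ` W"
      using eq[symmetric] unfolding cls_eq_iff[OF U'(1) U(1)] cls_eq_iff[OF U'(2) U(2)] by blast
    have "product U W \<subseteq> N" using U ultra_N N_mult unfolding product_def by blast
    then have "up_closure B (product U' W') = smul (t * s) ` up_closure B (product U W)"
      unfolding ts(2,4) product_smul
      by (rule up_closure_smul) (simp add: ts scalar_units_mult)
    then show ?thesis by (simp only: cls_smul[OF prod scalar_units_mult[OF ts(1,3)]])
  qed
  have gm: "gmult (Sigma_groupoid B) = (\<lambda>U V. up_closure B (product U V))"
    unfolding Sigma_groupoid_def product_def by simp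
  have "(THE k. \<exists>U' W'. (U', W') \<in> composable (Sigma_groupoid B) \<and> cls U = cls U' \<and>
      cls W = cls W' \<and> k = cls (up_closure B (product U' W'))) = cls (up_closure B (product U W))"
  proof (rule the_equality)
    show "\<exists>U' W'. (U', W') \<in> composable (Sigma_groupoid B) \<and> cls U = cls U' \<and> cls W = cls W' \<and>
        cls (up_closure B (product U W)) = cls (up_closure B (product U' W'))"
      using comp by blast
  qed (use uniq in blast)
  then show ?thesis
    unfolding G_groupoid_def quotient_groupoid_def gm by (simp only: top_groupoid.simps)
qed

lemma gsrc_cls:
  assumes U: "U \<in> ultrafilters B"
  shows "gsrc G (cls U) = cls (up_closure B (src U))"
  unfolding gsrc_def ginv_cls[OF U]
  by (subst gmult_cls)
    (simp_all add: composable_dagger up_closure_dagger_product up_closure_idem_ultrafilter src_ultra U)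

lemma grng_cls:
  assumes U: "U \<in> ultrafilters B"
  shows "grng G (cls U) = cls (up_closure B (rng U))"
  unfolding grng_def ginv_cls[OF U]
  by (subst gmult_cls)
    (simp_all add: composable_dagger' up_closure_product_dagger up_closure_idem_ultrafilter rng_ultra U)

lemma scalar_eq_one:
  assumes "e \<in> E" "e \<noteq> 0" "smul t e = e"
  shows "t = 1"
proof -
  have "smul (t - 1) e = 0" by (simp add: smul_diff_left smul_one assms)
  then show ?thesis using torsion_free[OF assms(1,2)] by force
qed

text \<open>
  Multiplication by a scalar unit does not change the source, so two units of \<open>\<Sigma>\<close> that become equal
  in \<open>G\<close> are equal already. Hence the isotropy of \<open>G\<close> is the image of that of \<open>\<Sigma>\<close>.
\<close>

lemma cls_up_closure_eq_iff:
  assumes F: "idem_ultrafilter F" "idem_ultrafilter F'"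
  shows "cls (up_closure B F) = cls (up_closure B F') \<longleftrightarrow> F = F'"
proof
  assume "cls (up_closure B F) = cls (up_closure B F')"
  then obtain t where t: "t \<in> scalar_units" "up_closure B F = smul t ` up_closure B F'"
    unfolding cls_eq_iff[OF up_closure_idem_ultrafilter(1)[OF F(1)] up_closure_idem_ultrafilter(1)[OF F(2)]] by blast
  have src_eq: "src (smul t ` U) = src U" for U
  proof -
    obtain s where s: "s * t = 1" using scalar_unitsE[OF t(1)] by blast
    have "smul t a = smul t b \<longleftrightarrow> a = b" for a b
      by (metis s smul_smul smul_one)
    then show ?thesis unfolding src_def by (simp add: smul_mult_left)
  qed
  show "F = F'"
    using up_closure_idem_ultrafilter(2)[OF F(1)] up_closure_idem_ultrafilter(2)[OF F(2)] src_eq t(2) by metis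
qed simp

definition isotropic :: "'a set \<Rightarrow> bool" where
  "isotropic U \<longleftrightarrow> rng U = src U"

text \<open>
  Scalar germs are the ultrafilters equivalent to one that contains an idempotent.
\<close>

definition scalar_germ :: "'a set \<Rightarrow> bool" where
  "scalar_germ U \<longleftrightarrow> (\<exists>t\<in>scalar_units. \<exists>e\<in>E. smul t e \<in> U)"

lemma arrows_G: "arrows G = cls ` ultrafilters B"
  unfolding G_groupoid_def quotient_groupoid_def Sigma_groupoid_def by (auto simp: quotient_def)

lemma cls_in_isotropy:
  assumes "U \<in> ultrafilters B"
  shows "cls U \<in> isotropy G \<longleftrightarrow> isotropic U"
  using assms unfolding isotropy_def isotropic_def arrows_G
  by (simp add: gsrc_cls grng_cls cls_up_closure_eq_iff src_ultra rng_ultra)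

lemma cls_in_unit_space:
  assumes U: "U \<in> ultrafilters B"
  shows "cls U \<in> unit_space G \<longleftrightarrow> scalar_germ U"
proof
  assume "cls U \<in> unit_space G"
  then obtain W e where W: "W \<in> ultrafilters B" "cls U = cls W" and e: "e \<in> W" "e \<in> E"
    unfolding G_groupoid_def quotient_groupoid_def Sigma_groupoid_def by auto
  then show "scalar_germ U" unfolding scalar_germ_def cls_eq_iff[OF U W(1)] by blast
next
  assume "scalar_germ U"
  then obtain t e where t: "t \<in> scalar_units" and e: "e \<in> E" "smul t e \<in> U"
    unfolding scalar_germ_def by blast
  obtain s where s: "s \<in> scalar_units" "t * s = 1" "s * t = 1" using scalar_unitsE[OF t] .
  have W: "smul s ` U \<in> ultrafilters B" by (rule smul_ultra[OF U s(1)])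
  have "e = smul s (smul t e)" by (simp add: smul_smul smul_one s)
  then have "e \<in> smul s ` U" using e(2) by blast
  moreover have "cls U = cls (smul s ` U)" by (rule cls_smul[OF U s(1), symmetric])
  ultimately show "cls U \<in> unit_space G"
    using W e(1) unfolding G_groupoid_def quotient_groupoid_def Sigma_groupoid_def by auto
qed

lemma unit_space_arrows: "unit_space G \<subseteq> arrows G"
  unfolding arrows_G unfolding G_groupoid_def quotient_groupoid_def Sigma_groupoid_def by auto

lemma isotropy_arrows: "isotropy G \<subseteq> arrows G"
  unfolding isotropy_def by blast

lemma scalar_germ_isotropic:
  assumes U: "U \<in> ultrafilters B" and sc: "scalar_germ U"
  shows "isotropic U"
proof -
  obtain t e where t: "t \<in> scalar_units" and e: "e \<in> E" "smul t e \<in> U"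
    using sc unfolding scalar_germ_def by blast
  obtain s where s: "t * s = 1" "s * t = 1" using scalar_unitsE[OF t] by blast
  let ?n = "smul t e"
  have 1: "?n\<dagger> = smul s e" by (simp add: dagger_smul[OF E_N[OF e(1)] s(1)] E_dagger e)
  have eU: "e \<in> src U"
    unfolding src_def using e by (auto simp: smul_mult_left E_idem intro!: bexI[OF _ e(2)])
  have "rng U = src U"
  proof (intro set_eqI)
    fix f
    have "f \<in> rng U \<longleftrightarrow> f \<in> src U" if f: "f \<in> E"
    proof -
      have "f \<in> rng U \<longleftrightarrow> e * f \<in> src U"
        unfolding rng_iff_conj[OF U e(2) f] 1 using f e(1)
        by (simp add: smul_mult_left smul_mult_right smul_smul s smul_one E_comm E_absorb)
      also have "\<dots> \<longleftrightarrow> f \<in> src U"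
        using idem_filter_mult idem_filter_factor(2)[OF idem_ultrafilter_idem_filter[OF src_ultra[OF U]] _ e(1) f]
          idem_ultrafilter_idem_filter[OF src_ultra[OF U]] eU by blast
      finally show ?thesis .
    qed
    then show "f \<in> rng U \<longleftrightarrow> f \<in> src U" unfolding rng_def src_def by blast
  qed
  then show ?thesis unfolding isotropic_def .
qed

lemma principal_iff:
  "principal_groupoid G \<longleftrightarrow> (\<forall>U\<in>ultrafilters B. isotropic U \<longrightarrow> scalar_germ U)"
proof -
  have "principal_groupoid G \<longleftrightarrow> (\<forall>g\<in>arrows G. g \<in> isotropy G \<longleftrightarrow> g \<in> unit_space G)"
    unfolding principal_groupoid_def using unit_space_arrows isotropy_arrows by blast
  also have "\<dots> \<longleftrightarrow> (\<forall>U\<in>ultrafilters B. isotropic U \<longleftrightarrow> scalar_germ U)"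
    unfolding arrows_G by (simp add: cls_in_isotropy cls_in_unit_space)
  finally show ?thesis using scalar_germ_isotropic by auto
qed

text \<open>
  The sets of ultrafilters through a given normaliser form a basis: if \<open>U\<close> contains \<open>m\<close> and \<open>n\<close>, then
  it contains a common lower bound \<open>w\<close>, and every ultrafilter through \<open>w\<close> contains both.
\<close>

lemma openin_Sigma:
  "openin (gtop (Sigma_groupoid B)) S \<longleftrightarrow>
     S \<subseteq> ultrafilters B \<and> (\<forall>U\<in>S. \<exists>n\<in>U. ultra_basic B n \<subseteq> S)"
proof -
  let ?O = "\<lambda>S. S \<subseteq> ultrafilters B \<and> (\<forall>U\<in>S. \<exists>n\<in>U. ultra_basic B n \<subseteq> S)"
  have gt: "gtop (Sigma_groupoid B) = topology_generated_by (ultra_basic B ` N)"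
    unfolding Sigma_groupoid_def by simp
  have O_Int: "?O (S \<inter> T)" if S: "?O S" and T: "?O T" for S T
  proof (intro conjI ballI)
    show "S \<inter> T \<subseteq> ultrafilters B" using S by blast
    fix U assume U: "U \<in> S \<inter> T"
    obtain m where m: "m \<in> U" "ultra_basic B m \<subseteq> S" using S U by blast
    obtain n where n: "n \<in> U" "ultra_basic B n \<subseteq> T" using T U by blast
    have Uu: "U \<in> ultrafilters B" using S U by blast
    obtain w where w: "w \<in> U" "w \<preceq> m" "w \<preceq> n"
      using nfilter_down[OF ultra_nfilter[OF Uu] m(1) n(1)] .
    have "ultra_basic B w \<subseteq> ultra_basic B m \<inter> ultra_basic B n"
      unfolding ultra_basic_def
      using w(2,3) ultra_N[OF Uu m(1)] ultra_N[OF Uu n(1)] nfilter_up[OF ultra_nfilter] by blast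
    with w(1) m n show "\<exists>n\<in>U. ultra_basic B n \<subseteq> S \<inter> T" by blast
  qed
  have "?O S" if "generate_topology_on (ultra_basic B ` N) S" for S
    using that
  proof induction
    case (Int S T)
    from Int.IH show ?case by (rule O_Int)
  next
    case (UN K)
    then show ?case by (meson Sup_least UnionE Union_upper order_trans)
  next
    case (Basis S)
    then show ?case unfolding ultra_basic_def by blast
  qed simp
  moreover have "openin (gtop (Sigma_groupoid B)) S" if S: "?O S"
  proof -
    have "S = \<Union>{ultra_basic B n | n. n \<in> N \<and> ultra_basic B n \<subseteq> S}" (is "S = \<Union>?K")
    proof
      show "S \<subseteq> \<Union>?K"
      proof
        fix U assume U: "U \<in> S"
        with S obtain n where n: "n \<in> U" "ultra_basic B n \<subseteq> S" by blast
        have Uu: "U \<in> ultrafilters B" using U S by blast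
        then have "U \<in> ultra_basic B n" "n \<in> N"
          using n ultra_N unfolding ultra_basic_def by blast+
        with n(2) show "U \<in> \<Union>?K" by blast
      qed
    qed blast
    moreover have "openin (gtop (Sigma_groupoid B)) (\<Union>?K)"
      unfolding gt by (rule openin_Union) (auto intro: topology_generated_by_Basis)
    ultimately show ?thesis by simp
  qed
  ultimately show ?thesis unfolding gt openin_topology_generated_by_iff by blast
qed

lemma topspace_Sigma: "topspace (gtop (Sigma_groupoid B)) = ultrafilters B"
proof
  show "topspace (gtop (Sigma_groupoid B)) \<subseteq> ultrafilters B"
    using openin_topspace[of "gtop (Sigma_groupoid B)"] unfolding openin_Sigma by (rule conjunct1)
  have "openin (gtop (Sigma_groupoid B)) (ultrafilters B)"
    unfolding openin_Sigma ultra_basic_def using ultra_nonempty by blast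
  then show "ultrafilters B \<subseteq> topspace (gtop (Sigma_groupoid B))" by (rule openin_subset)
qed

lemma openin_G:
  "openin (gtop G) S \<longleftrightarrow> S \<subseteq> cls ` ultrafilters B \<and>
     (\<forall>U\<in>ultrafilters B. cls U \<in> S \<longrightarrow>
       (\<exists>n\<in>U. \<forall>W\<in>ultrafilters B. n \<in> W \<longrightarrow> cls W \<in> S))"
proof -
  have gt: "gtop G = quotient_top (gtop (Sigma_groupoid B)) (\<lambda>U. cls U)"
    unfolding G_groupoid_def quotient_groupoid_def by simp
  have "{V \<in> ultrafilters B. n \<in> V} \<subseteq> {V \<in> ultrafilters B. Q V} \<longleftrightarrow>
      (\<forall>W\<in>ultrafilters B. n \<in> W \<longrightarrow> Q W)" for n and Q :: "'a set \<Rightarrow> bool"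
    by blast
  then show ?thesis
    unfolding gt openin_quotient_top topspace_Sigma openin_Sigma ultra_basic_def
    by (simp add: Ball_def imp_conjL)
qed

text \<open>
  The quotient map is open, because the saturation of the set of ultrafilters through \<open>n\<close> is the
  union of the sets of ultrafilters through \<open>t n\<close>, with \<open>t\<close> a scalar unit. The interior of the
  isotropy can therefore be tested on the ultrafilters through a single normaliser, and it contains
  the unit space, which is open.
\<close>

lemma effective_iff:
  "effective_groupoid G \<longleftrightarrow>
     (\<forall>n\<in>N. (\<forall>U\<in>ultrafilters B. n \<in> U \<longrightarrow> isotropic U) \<longrightarrow>
       (\<forall>U\<in>ultrafilters B. n \<in> U \<longrightarrow> scalar_germ U))" (is "_ \<longleftrightarrow> ?R")
proof -
  have "openin (gtop G) (unit_space G)"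
    unfolding openin_G
  proof (intro conjI ballI impI)
    show "unit_space G \<subseteq> cls ` ultrafilters B" using unit_space_arrows arrows_G by simp
    fix U assume U: "U \<in> ultrafilters B" and "cls U \<in> unit_space G"
    then obtain t e where "t \<in> scalar_units" "e \<in> E" "smul t e \<in> U"
      unfolding cls_in_unit_space[OF U] scalar_germ_def by blast
    then show "\<exists>n\<in>U. \<forall>W\<in>ultrafilters B. n \<in> W \<longrightarrow> cls W \<in> unit_space G"
      using cls_in_unit_space unfolding scalar_germ_def by blast
  qed
  moreover have "unit_space G \<subseteq> isotropy G"
    using unit_space_arrows cls_in_unit_space cls_in_isotropy scalar_germ_isotropic
    unfolding arrows_G by blast
  ultimately have "unit_space G \<subseteq> gtop G interior_of isotropy G"
    unfolding interior_of_def by blast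
  then have eff: "effective_groupoid G \<longleftrightarrow>
      (\<forall>S. openin (gtop G) S \<longrightarrow> S \<subseteq> isotropy G \<longrightarrow> S \<subseteq> unit_space G)"
    unfolding effective_groupoid_def interior_of_def by blast
  show ?thesis
    unfolding eff
  proof (intro iffI ballI allI impI)
    fix n U
    assume L: "\<forall>S. openin (gtop G) S \<longrightarrow> S \<subseteq> isotropy G \<longrightarrow> S \<subseteq> unit_space G"
      and n: "n \<in> N" "\<forall>U\<in>ultrafilters B. n \<in> U \<longrightarrow> isotropic U"
      and U: "U \<in> ultrafilters B" "n \<in> U"
    let ?S = "cls ` {W \<in> ultrafilters B. n \<in> W}"
    have "openin (gtop G) ?S"
      unfolding openin_G
    proof (intro conjI ballI impI)
      fix V assume V: "V \<in> ultrafilters B" "cls V \<in> ?S"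
      then obtain W where W: "W \<in> ultrafilters B" "n \<in> W" "cls V = cls W" by blast
      then obtain t where t: "t \<in> scalar_units" "V = smul t ` W"
        using cls_eq_iff[OF V(1) W(1)] by blast
      obtain s where s: "s \<in> scalar_units" "t * s = 1" "s * t = 1" using scalar_unitsE[OF t(1)] .
      have "cls V' \<in> ?S" if V': "V' \<in> ultrafilters B" "smul t n \<in> V'" for V'
      proof -
        have W': "smul s ` V' \<in> ultrafilters B" by (rule smul_ultra[OF V'(1) s(1)])
        have "n = smul s (smul t n)" by (simp add: smul_smul smul_one s)
        then have "n \<in> smul s ` V'" using V'(2) by blast
        moreover have "cls V' = cls (smul s ` V')" by (rule cls_smul[OF V'(1) s(1), symmetric])
        ultimately show ?thesis using W' by blast
      qed
      moreover have "smul t n \<in> V" using t(2) W(2) by blast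
      ultimately show "\<exists>n\<in>V. \<forall>W\<in>ultrafilters B. n \<in> W \<longrightarrow> cls W \<in> ?S" by blast
    qed blast
    moreover have "?S \<subseteq> isotropy G" using n(2) cls_in_isotropy by blast
    ultimately have "cls U \<in> unit_space G" using L U by blast
    then show "scalar_germ U" using cls_in_unit_space[OF U(1)] by simp
  next
    fix S assume R: ?R and S: "openin (gtop G) S" "S \<subseteq> isotropy G"
    have "cls U \<in> unit_space G" if U: "U \<in> ultrafilters B" "cls U \<in> S" for U
    proof -
      obtain n where n: "n \<in> U" "\<forall>W\<in>ultrafilters B. n \<in> W \<longrightarrow> cls W \<in> S"
        using S(1) U unfolding openin_G by blast
      then have "\<forall>W\<in>ultrafilters B. n \<in> W \<longrightarrow> isotropic W"
        using S(2) cls_in_isotropy by blast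
      with R U(1) n(1) ultra_N have "scalar_germ U" by blast
      then show ?thesis using cls_in_unit_space[OF U(1)] by simp
    qed
    then show "S \<subseteq> unit_space G" using S(1) unfolding openin_G by blast
  qed
qed

end


section \<open>Scalar germs and the subalgebra\<close>

context algebraic_pair
begin

lemma P_B: "P a \<in> B"
  and P_fix: "b \<in> B \<Longrightarrow> P b = b"
  and P_add: "P (a + a') = P a + P a'"
  and P_bimodule: "b \<in> B \<Longrightarrow> b' \<in> B \<Longrightarrow> P (b * a * b') = b * P a * b'"
  using expectation unfolding cond_expectation_def by blast+

lemma P_zero: "P 0 = 0"
  by (rule P_fix[OF B_zero])

lemma P_diff: "P (a - a') = P a - P a'"
  using P_add[of "a - a'" a'] by (simp add: algebra_simps)

lemma P_mult_left: "b \<in> B \<Longrightarrow> P (b * a) = b * P a"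
proof -
  assume b: "b \<in> B"
  obtain e where e: "e \<in> E" "(b * a) * e = b * a" "P a * e = P a"
    using common_unit[of "{b * a, P a}"] by (metis finite.simps insert_iff)
  have "P (b * a) = P (b * a * e)" by (simp add: e)
  also have "\<dots> = b * (P a * e)" using P_bimodule[OF b E_B[OF e(1)]] by (simp add: mult.assoc)
  finally show ?thesis by (simp add: e)
qed

lemma P_mult_right: "b \<in> B \<Longrightarrow> P (a * b) = P a * b"
proof -
  assume b: "b \<in> B"
  obtain e where e: "e \<in> E" "e * (a * b) = a * b" "e * P a = P a"
    using common_unit[of "{a * b, P a}"] by (metis finite.simps insert_iff)
  have "P (a * b) = P (e * a * b)" by (simp add: e mult.assoc)
  also have "\<dots> = (e * P a) * b" using P_bimodule[OF E_B[OF e(1)] b] by simp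
  finally show ?thesis by (simp add: e)
qed

text \<open>
  Apply \<open>P\<close> to the idempotent \<open>n\<dagger> n\<close>: with \<open>n \<in> B\<close> this gives \<open>n\<dagger> n = P (n\<dagger>) n\<close>, whence
  \<open>n\<dagger> = P (n\<dagger>) n n\<dagger>\<close>.
\<close>

lemma dagger_in_B:
  assumes n: "n \<in> N" and b: "n \<in> B"
  shows "n\<dagger> \<in> B"
proof -
  have E: "n\<dagger> * n \<in> B" "n * n\<dagger> \<in> B" using N_dagger_mult N_mult_dagger E_B n by blast+
  have "n\<dagger> = (n\<dagger> * n) * n\<dagger>" by (simp add: mult.assoc inv_simps[OF n])
  also have "n\<dagger> * n = P (n\<dagger>) * n" using P_mult_right[OF b, of "n\<dagger>"] P_fix[OF E(1)] by simp
  also have "\<dots> * n\<dagger> = P (n\<dagger>) * (n * n\<dagger>)" by (simp add: mult.assoc)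
  also have "\<dots> \<in> B" by (rule B_mult[OF P_B E(2)])
  finally show ?thesis .
qed

text \<open>
  Elements of \<open>B\<close> are the locally constant functions on the space of ultrafilters of idempotents:
  on a small member of \<open>F\<close>, each of the finitely many idempotents in a linear combination is
  constant.
\<close>

lemma B_locally_scalar:
  assumes F: "idem_ultrafilter F" and b: "b \<in> B"
  shows "\<exists>f\<in>F. \<exists>t. b * f = smul t f"
proof -
  note F' = idem_ultrafilter_idem_filter[OF F]
  obtain S c where S: "finite S" "S \<subseteq> E" "b = (\<Sum>x\<in>S. smul (c x) x)"
    using b B_span unfolding lin_span_def by blast
  have "\<exists>f\<in>F. \<forall>x\<in>S. x * f = f \<or> x * f = 0"
  proof (rule idem_filter_common[OF F' S(1)])
    fix x assume "x \<in> S"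
    then have x: "x \<in> E" using S(2) by blast
    show "\<exists>f\<in>F. x * f = f \<or> x * f = 0"
      using idem_ultrafilter_disjoint[OF F x] E_idem[OF x] by metis
  next
    fix x f g :: 'a assume "x * f = f \<or> x * f = 0"
    moreover have "x * (f * g) = (x * f) * g" by (simp add: mult.assoc)
    ultimately show "x * (f * g) = f * g \<or> x * (f * g) = 0" by auto
  qed
  then obtain f where f: "f \<in> F" "\<forall>x\<in>S. x * f = f \<or> x * f = 0" by blast
  have "b * f = (\<Sum>x\<in>S. smul (if x * f = f then c x else 0) f)"
    unfolding S(3) sum_distrib_right smul_mult_left by (rule sum.cong) (use f(2) in auto)
  with f(1) show ?thesis unfolding smul_sum_left[symmetric] by blast
qed

text \<open>
  Near the source, \<open>n\<close> and \<open>n\<dagger>\<close> are scalars \<open>t\<close> and \<open>s\<close>. Since \<open>n\<dagger> n\<close> is an idempotent of the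
  source, \<open>t s\<close> acts as one on a nonzero idempotent, and absence of torsion makes \<open>t\<close> a unit.
\<close>

lemma scalar_germ_if_in_B:
  assumes U: "U \<in> ultrafilters B" and n: "n \<in> U" "n \<in> B"
  shows "scalar_germ U"
proof -
  note F = src_ultra[OF U] and nf = ultra_nfilter[OF U]
  note F' = idem_ultrafilter_idem_filter[OF F]
  have nN: "n \<in> N" by (rule ultra_N[OF U n(1)])
  obtain f t where f: "f \<in> src U" "n * f = smul t f"
    using B_locally_scalar[OF F n(2)] by blast
  obtain g s where g: "g \<in> src U" "n\<dagger> * g = smul s g"
    using B_locally_scalar[OF F dagger_in_B[OF nN n(2)]] by blast
  have E: "f \<in> E" "g \<in> E" "n\<dagger> * n \<in> E"
    using f(1) g(1) idem_filter_E[OF F'] N_dagger_mult[OF nN] by blast+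
  let ?h = "(n\<dagger> * n) * (f * g)"
  have hU: "?h \<in> src U"
    by (intro idem_filter_mult[OF F'] src_dagger_mult[OF nf n(1)] f g)
  have "?h = n\<dagger> * ((n * f) * g)" by (simp add: mult.assoc)
  also have "\<dots> = smul (t * s) (f * g)"
    unfolding f(2) using g(2) E_comm[OF E(1,2)]
    by (simp add: smul_mult_left smul_mult_right) (metis mult.assoc smul_mult_left smul_smul)
  finally have h: "?h = smul (t * s) (f * g)" .
  then have "smul (t * s) ?h = ?h"
    using E by (metis E_absorb E_mult E_comm smul_mult_right mult.assoc)
  then have "t * s = 1"
    by (rule scalar_eq_one[OF idem_filter_E[OF F' hU] idem_filter_nonzero[OF F' hU]])
  then have "t \<in> scalar_units" unfolding scalar_units_def by (metis dvd_triv_left mem_Collect_eq)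
  moreover have "smul t f \<in> U" using nfilter_mult_src[OF nf n(1) f(1)] f(2) by simp
  ultimately show ?thesis unfolding scalar_germ_def using E(1) by blast
qed

lemma in_B_if_scalar_germs:
  assumes n: "n \<in> N" and sc: "\<And>U. U \<in> ultrafilters B \<Longrightarrow> n \<in> U \<Longrightarrow> scalar_germ U"
  shows "n \<in> B"
proof -
  let ?J = "{j \<in> E. n * j \<in> B}"
  have "idem_ideal ?J"
    unfolding idem_ideal_def
  proof (intro conjI ballI)
    show "0 \<in> ?J" by (simp add: E_zero B_zero)
    show "j * e \<in> ?J" if "j \<in> ?J" "e \<in> E" for j e
      using that by (simp add: E_mult mult.assoc[symmetric] B_mult E_B)
    show "i + j - i * j \<in> ?J" if "i \<in> ?J" "j \<in> ?J" for i j
      using that by (simp add: E_join distrib_left right_diff_distrib mult.assoc[symmetric]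
        B_add B_diff B_mult E_B)
  qed blast
  then have "n\<dagger> * n \<in> ?J"
  proof (rule idem_ideal_compact[OF _ N_dagger_mult[OF n]])
    fix F assume F: "idem_ultrafilter F" "n\<dagger> * n \<in> F"
    note germ = germ_ultra[OF F(1) n F(2)]
    obtain t e where e: "e \<in> E" "smul t e \<in> germ n F"
      using sc[OF germ(1,3)] unfolding scalar_germ_def by blast
    then obtain f where f: "f \<in> F" "n * f \<preceq> smul t e" "smul t e \<in> N"
      unfolding germ_def by blast
    have fE: "f \<in> E" using idem_filter_E[OF idem_ultrafilter_idem_filter[OF F(1)] f(1)] .
    obtain g where "g \<in> E" "n * f = smul t e * g"
      using f(2) nle_iff_right[OF N_mult_E[OF n fE] f(3)] by blast
    then have "n * f \<in> B" using e(1) by (simp add: B_mult B_smul E_B)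
    then show "F \<inter> ?J \<noteq> {}" using f(1) fE by blast
  qed
  then show ?thesis by (simp add: inv_simps[OF n])
qed

text \<open>
  Conjugation by \<open>n\<close> describes the passage from source to range, so isotropy of all germs says that
  \<open>e\<close> and \<open>n\<dagger> e n\<close> belong to the same ultrafilters through \<open>n\<dagger> n\<close>. Ultrafilters separate
  idempotents, and therefore the two agree below \<open>n\<dagger> n\<close>.
\<close>

lemma isotropic_iff_commutes:
  assumes n: "n \<in> N"
  shows "(\<forall>U\<in>ultrafilters B. n \<in> U \<longrightarrow> isotropic U) \<longleftrightarrow> (\<forall>e\<in>E. n * e = e * n)"
proof (intro iffI ballI impI)
  fix U assume comm: "\<forall>e\<in>E. n * e = e * n" and U: "U \<in> ultrafilters B" "n \<in> U"
  note F = idem_ultrafilter_idem_filter[OF src_ultra[OF U(1)]]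
  have d: "n\<dagger> * n \<in> src U" by (rule src_dagger_mult[OF ultra_nfilter[OF U(1)] U(2)])
  have "e \<in> rng U \<longleftrightarrow> e \<in> src U" if e: "e \<in> E" for e
  proof -
    have "e \<in> rng U \<longleftrightarrow> (n\<dagger> * n) * e \<in> src U"
      unfolding rng_iff_conj[OF U e] using comm e by (simp add: mult.assoc)
    also have "\<dots> \<longleftrightarrow> e \<in> src U"
      using idem_filter_mult[OF F d] idem_filter_factor(2)[OF F _ N_dagger_mult[OF n] e] by blast
    finally show ?thesis .
  qed
  then show "isotropic U" unfolding isotropic_def rng_def src_def by blast
next
  fix e assume iso: "\<forall>U\<in>ultrafilters B. n \<in> U \<longrightarrow> isotropic U" and e: "e \<in> E"
  let ?d = "n\<dagger> * n" and ?k = "n\<dagger> * (e * n)"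
  have E: "?d \<in> E" "?k \<in> E" using N_dagger_mult E_conj' n e by blast+
  have same: "e \<in> F \<longleftrightarrow> ?k \<in> F" if F: "idem_ultrafilter F" "?d \<in> F" for F
    using iso rng_iff_conj[OF _ _ e] germ_ultra[OF F(1) n F(2)]
    unfolding isotropic_def by metis
  \<comment> \<open>below \<open>n\<dagger> n\<close>, membership of ultrafilters reflects the order of idempotents\<close>
  have sep: "?d * x - (?d * x) * y = 0"
    if xy: "x \<in> E" "y \<in> E" "\<And>F. idem_ultrafilter F \<Longrightarrow> ?d \<in> F \<Longrightarrow> x \<in> F \<Longrightarrow> y \<in> F" for x y
  proof (rule ccontr)
    let ?z = "?d * x - (?d * x) * y"
    assume nz: "?z \<noteq> 0"
    have z: "?z \<in> E" by (intro E_diff E_mult E xy)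
    obtain F where F: "idem_ultrafilter F" "?z \<in> F" using idem_ultrafilter_exists[OF z nz] .
    note F' = idem_ultrafilter_idem_filter[OF F(1)]
    have "(d * x - (d * x) * y) * d = d * x - (d * x) * y" "(d * x - (d * x) * y) * y = 0"
      "(d * x - (d * x) * y) * x = d * x - (d * x) * y" if "d \<in> E" for d
      using that xy(1,2)
      by (simp_all add: left_diff_distrib mult.assoc E_comm E_comm_left E_idem E_absorb)
    from this[OF E(1)]
    have "?d \<in> F" "x \<in> F" "?z * y = 0"
      using idem_filter_up[OF F'] F(2) E(1) xy(1) by blast+
    with xy(3)[OF F(1)] idem_filter_mult[OF F' F(2)] idem_filter_nonzero[OF F'] show False by blast
  qed
  have "?d * e = (?d * e) * ?k" "?d * ?k = (?d * ?k) * e"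
    using sep[OF e E(2)] sep[OF E(2) e] same by simp_all
  moreover have "(?d * e) * ?k = (?d * ?k) * e"
    using E_comm[OF e E(2)] by (simp only: mult.assoc)
  ultimately have de: "?d * e = ?d * ?k" by simp
  have "n * e = n * (?d * e)" by (simp add: mult.assoc inv_simps[OF n])
  also have "\<dots> = n * ?k" unfolding de by (simp add: mult.assoc inv_simps[OF n])
  also have "\<dots> = e * n" by (rule move_right[OF n e, symmetric])
  finally show "n * e = e * n" .
qed

lemma commutes_with_B:
  assumes "\<And>e. e \<in> E \<Longrightarrow> a * e = e * a" and b: "b \<in> B"
  shows "a * b = b * a"
proof -
  obtain S c where S: "S \<subseteq> E" "b = (\<Sum>x\<in>S. smul (c x) x)"
    using b B_span unfolding lin_span_def by blast
  show ?thesis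
    unfolding S(2) sum_distrib_left sum_distrib_right smul_mult_left smul_mult_right
    by (rule sum.cong) (use assms(1) S(1) in auto)
qed

end


section \<open>Maximal commutativity and effectiveness\<close>

text \<open>
  The double commutant of \<open>B\<close> together with \<open>a\<close> is a commutative subalgebra.
\<close>

lemma (in local_unit_subalgebra) maximal_comm_imp_in_B:
  assumes max: "maximal_comm_subalgebra smul B" and a: "\<And>b. b \<in> B \<Longrightarrow> a * b = b * a"
  shows "a \<in> B"
proof -
  define Z where "Z S = {c. \<forall>x\<in>S. c * x = x * c}" for S :: "'a set"
  let ?S = "insert a B"
  have S: "?S \<subseteq> Z ?S" using a B_comm unfolding Z_def by auto
  have sub: "subalgebra smul (Z S)" for S
    unfolding subalgebra_def Z_def
    by (auto simp: distrib_left distrib_right smul_mult_left smul_mult_right)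
      (metis mult.assoc)
  have comm: "comm_subalgebra smul (Z (Z ?S))"
    unfolding comm_subalgebra_def using sub S unfolding Z_def by blast
  have "?S \<subseteq> Z (Z ?S)" unfolding Z_def by auto
  with comm max show ?thesis unfolding maximal_comm_subalgebra_def by blast
qed

context algebraic_pair
begin

text \<open>
  The element \<open>a - P a\<close> commutes with \<open>B\<close> and has expectation zero; it is shown to vanish by
  faithfulness of \<open>P\<close>, localised at an idempotent in the support of \<open>P (n (a - P a))\<close>.
\<close>

lemma effective_imp_commutant:
  assumes eff: "effective_groupoid G" and a: "\<And>b. b \<in> B \<Longrightarrow> a * b = b * a"
  shows "a \<in> B"
proof (rule ccontr)
  assume "a \<notin> B"
  define a' where "a' = a - P a"
  have a': "a' \<noteq> 0" "P a' = 0" and comm: "\<And>b. b \<in> B \<Longrightarrow> a' * b = b * a'"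
    using \<open>a \<notin> B\<close> P_B[of a] P_fix[OF P_B] a B_comm[OF P_B]
    unfolding a'_def by (auto simp: P_diff left_diff_distrib right_diff_distrib)
  obtain n where n: "n \<in> N" "P (n * a') \<noteq> 0"
    using faithful_P a'(1) unfolding faithful_def by blast
  define b where "b = P (n * a')"
  have b: "b \<in> B" "b \<noteq> 0" using P_B n(2) unfolding b_def by auto
  \<comment> \<open>\<open>b\<close> is a function, so this confines its support to the points fixed by \<open>n\<close>\<close>
  have cut: "g * b * g' = 0" if "g \<in> E" "g' \<in> E" "g * n * g' = 0" for g g'
  proof -
    have "g * b * g' = P (g * (n * a') * g')"
      unfolding b_def using P_bimodule[OF E_B[OF that(1)] E_B[OF that(2)]] by simp
    also have "g * (n * a') * g' = (g * n * g') * a'"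
      by (simp add: mult.assoc comm E_B that)
    finally show ?thesis by (simp add: that(3) P_zero)
  qed
  \<comment> \<open>a point at which \<open>b\<close> does not vanish, and an idempotent \<open>e\<close> around it on which \<open>b\<close> is constant\<close>
  have "idem_ideal {j \<in> E. b * j = 0}"
    unfolding idem_ideal_def
    by (auto simp: E_zero E_mult E_join distrib_left right_diff_distrib mult.assoc[symmetric])
  moreover obtain u where "u \<in> E" "b * u = b" using common_unit[of "{b}"] by auto
  ultimately obtain F where F: "idem_ultrafilter F" "F \<inter> {j \<in> E. b * j = 0} = {}"
    using idem_ultrafilter_avoiding_ideal[of "{j \<in> E. b * j = 0}" u] b(2) by auto
  note F' = idem_ultrafilter_idem_filter[OF F(1)]
  obtain e t where e: "e \<in> F" "b * e = smul t e" using B_locally_scalar[OF F(1) b(1)] by blast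
  have eE: "e \<in> E" by (rule idem_filter_E[OF F' e(1)])
  have te: "smul t e \<noteq> 0" using F(2) e eE by auto
  then have t: "t \<noteq> 0" by auto
  have nonzero: "g * n * g' \<noteq> 0" if g: "g \<in> E" "g' \<in> E" "g * (g' * e) \<noteq> 0" for g g'
  proof
    assume "g * n * g' = 0"
    then have "0 = g * b * g' * e" using cut[OF g(1,2)] by simp
    also have "\<dots> = g * ((b * e) * g')" using E_comm[OF g(2) eE] by (simp add: mult.assoc)
    also have "\<dots> = smul t (g * (g' * e))"
      unfolding e(2) E_comm[OF g(2) eE] by (simp add: smul_mult_left smul_mult_right)
    finally show False
      using torsion_free[OF _ g(3)] t E_mult g(1,2) eE by auto
  qed
  have neN: "n * e \<in> N" by (rule N_mult_E[OF n(1) eE])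
  have iso: "isotropic U" if U: "U \<in> ultrafilters B" "n * e \<in> U" for U
  proof -
    note src = src_ultra[OF U(1)]
    note src' = idem_ultrafilter_idem_filter[OF src]
    have nU: "n \<in> U"
      by (rule nfilter_up[OF ultra_nfilter[OF U(1)] U(2) n(1) nle_mult_E[OF n(1) eE]])
    have "(n * e) * e = n * e" using eE by (simp add: mult.assoc E_idem)
    then have eU: "e \<in> src U" unfolding src_def using U(2) eE by blast
    have "h \<in> rng U" if h: "h \<in> src U" for h
    proof (rule ccontr)
      assume nh: "h \<notin> rng U"
      have hE: "h \<in> E" by (rule idem_filter_E[OF src' h])
      let ?k = "n\<dagger> * (h * n)"
      have "?k \<notin> src U" using rng_iff_conj[OF U(1) nU hE] nh by simp
      then obtain g where g: "g \<in> src U" "?k * g = 0"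
        using idem_ultrafilter_disjoint[OF src E_conj'[OF n(1) hE]] by blast
      have "h * n * g = (n * ?k) * g"
        by (rule arg_cong[OF move_right[OF n(1) hE]])
      also have "\<dots> = n * (?k * g)" by (rule mult.assoc)
      finally have "h * n * g = 0" by (simp add: g(2))
      moreover have "h * (g * e) \<noteq> 0"
        by (intro idem_filter_nonzero[OF src'] idem_filter_mult[OF src'] h g eU)
      ultimately show False using nonzero[OF hE idem_filter_E[OF src' g(1)]] by blast
    qed
    then have "rng U = src U"
      by (intro idem_ultrafilter_maximal[OF src] idem_ultrafilter_idem_filter rng_ultra U) blast
    then show ?thesis unfolding isotropic_def .
  qed
  have neB: "n * e \<in> B"
    by (rule in_B_if_scalar_germs[OF neN]) (use eff iso neN in \<open>auto simp: effective_iff\<close>)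
  have "smul t e = P (n * a') * e" using e(2) unfolding b_def by simp
  also have "\<dots> = P ((n * e) * a')"
    using P_mult_right[OF E_B[OF eE], of "n * a'"] comm[OF E_B[OF eE]] by (simp add: mult.assoc)
  also have "\<dots> = 0" using P_mult_left[OF neB, of a'] a'(2) by simp
  finally show False using te by simp
qed

lemma maximal_comm_imp_effective:
  assumes max: "maximal_comm_subalgebra smul B"
  shows "effective_groupoid G"
  unfolding effective_iff
proof (intro ballI impI)
  fix n U
  assume n: "n \<in> N" "\<forall>U\<in>ultrafilters B. n \<in> U \<longrightarrow> isotropic U"
    and U: "U \<in> ultrafilters B" "n \<in> U"
  have "\<forall>e\<in>E. n * e = e * n" using isotropic_iff_commutes[OF n(1)] n(2) by (rule iffD1)
  then have "n * b = b * n" if "b \<in> B" for b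
    by (intro commutes_with_B[OF _ that]) (rule bspec)
  then have "n \<in> B" by (rule maximal_comm_imp_in_B[OF max])
  then show "scalar_germ U" by (rule scalar_germ_if_in_B[OF U])
qed

lemma effective_imp_maximal_comm:
  assumes eff: "effective_groupoid G"
  shows "maximal_comm_subalgebra smul B"
  unfolding maximal_comm_subalgebra_def
proof (intro conjI allI impI comm_subalgebra_B)
  fix C assume C: "comm_subalgebra smul C \<and> B \<subseteq> C"
  have "a \<in> B" if "a \<in> C" for a
    by (rule effective_imp_commutant[OF eff]) (use C that in \<open>unfold comm_subalgebra_def, blast\<close>)
  with C show "C = B" by blast
qed

end


section \<open>Free normalisers and principality\<close>

lemma (in local_unit_subalgebra) free_normaliser_restrict:
  assumes m: "m \<in> free_normalisers B" and e: "e \<in> E"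
  shows "m * e \<in> free_normalisers B"
proof -
  have mN: "m \<in> N" using m unfolding free_normalisers_def by blast
  have meN: "m * e \<in> N" by (rule N_mult_E[OF mN e])
  show ?thesis
  proof (cases "m \<in> B")
    case True
    then show ?thesis using meN B_mult E_B[OF e] unfolding free_normalisers_def by blast
  next
    case False
    then have 0: "(m\<dagger> * m) * (m * m\<dagger>) = 0" using m unfolding free_normalisers_def by blast
    have d: "(m * e)\<dagger> = e * m\<dagger>" by (simp add: dagger_mult mN E_N e E_dagger)
    have "m * (e * (e * m\<dagger>)) = (m * m\<dagger>) * (m * (e * (e * m\<dagger>)))"
      by (simp add: mult.assoc inv_simps[OF mN])
    moreover have "(e * m\<dagger>) * (m * e) = e * (e * (m\<dagger> * m))"
      using E_comm[OF N_dagger_mult[OF mN] e] by (simp add: mult.assoc E_absorb[OF e])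
    ultimately have "((m * e)\<dagger> * (m * e)) * ((m * e) * (m * e)\<dagger>)
        = e * (e * (((m\<dagger> * m) * (m * m\<dagger>)) * (m * (e * (e * m\<dagger>)))))"
      unfolding d by (metis mult.assoc)
    then show ?thesis using meN unfolding 0 free_normalisers_def by simp
  qed
qed

context algebraic_pair
begin

text \<open>
  Locally, a normaliser \<open>n\<close> is either a scalar, and hence in \<open>B\<close>, or it moves the point \<open>F\<close>; in the
  second case, disjoint idempotents around the two points make a restriction of \<open>n\<close> free.
\<close>

lemma principal_imp_spanned:
  assumes pr: "principal_groupoid G" and n: "n \<in> N"
  shows "n \<in> lin_span smul (free_normalisers B)" (is "_ \<in> ?L")
proof -
  let ?J = "{j \<in> E. n * j \<in> ?L}"
  have L: "a * e \<in> ?L" if "a \<in> ?L" "e \<in> E" for a e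
    using that by (blast intro: lin_span_closed_right lin_span_base free_normaliser_restrict)
  have "idem_ideal ?J"
    unfolding idem_ideal_def
  proof (intro conjI ballI)
    show "0 \<in> ?J" by (simp add: E_zero lin_span_zero)
    show "j * e \<in> ?J" if "j \<in> ?J" "e \<in> E" for j e
      using that L[of "n * j" e] by (simp add: E_mult mult.assoc[symmetric])
    show "i + j - i * j \<in> ?J" if "i \<in> ?J" "j \<in> ?J" for i j
      using that L[of "n * i" j]
      by (simp add: E_join distrib_left right_diff_distrib mult.assoc[symmetric]
        lin_span_add lin_span_diff)
  qed blast
  then have "n\<dagger> * n \<in> ?J"
  proof (rule idem_ideal_compact[OF _ N_dagger_mult[OF n]])
    fix F assume F: "idem_ultrafilter F" "n\<dagger> * n \<in> F"
    note F' = idem_ultrafilter_idem_filter[OF F(1)] and germ = germ_ultra[OF F(1) n F(2)]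
    have "\<exists>f\<in>F. n * f \<in> free_normalisers B"
    proof (cases "isotropic (germ n F)")
      case True
      then have "scalar_germ (germ n F)" using pr germ(1) unfolding principal_iff by blast
      then obtain t e where e: "e \<in> E" "smul t e \<in> germ n F"
        unfolding scalar_germ_def by blast
      then obtain f where f: "f \<in> F" "n * f \<preceq> smul t e" "smul t e \<in> N"
        unfolding germ_def by blast
      have nf: "n * f \<in> N" by (rule N_mult_E[OF n idem_filter_E[OF F' f(1)]])
      obtain g where "g \<in> E" "n * f = smul t e * g"
        using f(2) nle_iff_right[OF nf f(3)] by blast
      then have "n * f \<in> B" using e(1) by (simp add: B_mult B_smul E_B)
      with nf f(1) show ?thesis unfolding free_normalisers_def by blast
    next
      case False
      have rng: "idem_ultrafilter (rng (germ n F))" by (rule rng_ultra[OF germ(1)])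
      have "\<not> F \<subseteq> rng (germ n F)"
        using False idem_ultrafilter_maximal[OF F(1) idem_ultrafilter_idem_filter[OF rng]] germ(2)
        unfolding isotropic_def by auto
      then obtain f where f: "f \<in> F" "f \<notin> rng (germ n F)" by blast
      have fE: "f \<in> E" by (rule idem_filter_E[OF F' f(1)])
      obtain g where g: "g \<in> rng (germ n F)" "f * g = 0"
        using idem_ultrafilter_disjoint[OF rng fE f(2)] by blast
      have gE: "g \<in> E" using g(1) unfolding rng_def by blast
      let ?k = "n\<dagger> * (g * n)"
      have k: "?k \<in> F" using g(1) rng_iff_conj[OF germ(1,3) gE] germ(2) by simp
      have kE: "?k \<in> E" by (rule idem_filter_E[OF F' k])
      \<comment> \<open>\<open>f\<close> and \<open>g\<close> are disjoint neighbourhoods of source and range; cutting by \<open>n\<dagger> g n\<close> pushes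
        the range of the restriction into \<open>g\<close>, cutting by \<open>f\<close> pushes its source into \<open>f\<close>\<close>
      let ?e = "?k * f"
      have e: "?e \<in> F" "?e \<in> E" using idem_filter_mult[OF F' k f(1)] idem_filter_E[OF F'] by blast+
      have neN: "n * ?e \<in> N" by (rule N_mult_E[OF n e(2)])
      have "g * (n * ?e) = n * ?e"
        using move_right[OF n gE] E_absorb[OF kE] by (metis mult.assoc)
      moreover have "(n * ?e) * f = n * ?e" using E_idem[OF fE] by (simp add: mult.assoc)
      ultimately have "((n * ?e)\<dagger> * (n * ?e)) * ((n * ?e) * (n * ?e)\<dagger>)
          = ((n * ?e)\<dagger> * (n * ?e)) * (f * g) * ((n * ?e) * (n * ?e)\<dagger>)"
        by (metis mult.assoc)
      then have "n * ?e \<in> free_normalisers B"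
        using neN unfolding free_normalisers_def g(2) by simp
      with e(1) show ?thesis by blast
    qed
    then show "F \<inter> ?J \<noteq> {}" using lin_span_base idem_filter_E[OF F'] by blast
  qed
  then show ?thesis by (simp add: inv_simps[OF n])
qed

text \<open>
  A free normaliser \<open>m \<notin> B\<close> has disjoint domain and range, so at least one of them misses the point,
  and \<open>f m f = 0\<close> for a small idempotent \<open>f\<close> at this point.
\<close>

lemma spanned_imp_principal:
  assumes span: "UNIV = lin_span smul (free_normalisers B)"
  shows "principal_groupoid G"
  unfolding principal_iff
proof (intro ballI impI)
  fix U assume U: "U \<in> ultrafilters B" and "isotropic U"
  then have iso: "rng U = src U" unfolding isotropic_def by simp
  note F = src_ultra[OF U] and nf = ultra_nfilter[OF U]
  note F' = idem_ultrafilter_idem_filter[OF F]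
  obtain n where n: "n \<in> U" using ultra_nonempty[OF U] by blast
  obtain S c where S: "finite S" "S \<subseteq> free_normalisers B" "n = (\<Sum>m\<in>S. smul (c m) m)"
    using span unfolding lin_span_def by blast
  have "\<exists>f\<in>src U. \<forall>m\<in>S. f * (m * f) \<in> B"
  proof (rule idem_filter_common[OF F' S(1)])
    fix m assume "m \<in> S"
    then have m: "m \<in> N" "m \<in> B \<or> (m\<dagger> * m) * (m * m\<dagger>) = 0"
      using S(2) unfolding free_normalisers_def by blast+
    note E = N_dagger_mult[OF m(1)] N_mult_dagger[OF m(1)]
    consider "m \<in> B" | "m\<dagger> * m \<notin> src U" | "m * m\<dagger> \<notin> src U"
      using m(2) idem_filter_mult[OF F'] idem_filter_nonzero[OF F'] by blast
    then show "\<exists>f\<in>src U. f * (m * f) \<in> B"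
    proof cases
      case 1
      have "n\<dagger> * n \<in> src U" by (rule src_dagger_mult[OF nf n])
      with 1 show ?thesis using B_mult E_B idem_filter_E[OF F'] by blast
    next
      case 2
      then obtain f where f: "f \<in> src U" "(m\<dagger> * m) * f = 0" using idem_ultrafilter_disjoint[OF F E(1)] by blast
      have "m * f = m * ((m\<dagger> * m) * f)" by (simp add: mult.assoc inv_simps[OF m(1)])
      then have "f * (m * f) = 0" using f(2) by simp
      with B_zero show ?thesis using f(1) by (intro bexI[of _ f]) simp_all
    next
      case 3
      then obtain f where f: "f \<in> src U" "(m * m\<dagger>) * f = 0" using idem_ultrafilter_disjoint[OF F E(2)] by blast
      have "f * m = (f * (m * m\<dagger>)) * m" by (simp add: mult.assoc inv_simps[OF m(1)])
      also have "\<dots> = 0" using f E_comm[OF idem_filter_E[OF F' f(1)] E(2)] by simp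
      finally have "f * (m * f) = 0" by (simp add: mult.assoc[symmetric])
      with B_zero show ?thesis using f(1) by (intro bexI[of _ f]) simp_all
    qed
  next
    fix m f g :: 'a assume fm: "f * (m * f) \<in> B" and fg: "f \<in> src U" "g \<in> src U"
    have "(f * g) * (m * (f * g)) = g * (f * (m * f)) * g"
      using E_comm[OF idem_filter_E[OF F' fg(1)] idem_filter_E[OF F' fg(2)]] by (simp add: mult.assoc)
    also have "\<dots> \<in> B" by (intro B_mult fm E_B idem_filter_E[OF F'] fg)
    finally show "(f * g) * (m * (f * g)) \<in> B" .
  qed
  then obtain f where f: "f \<in> src U" "\<forall>m\<in>S. f * (m * f) \<in> B" by blast
  have "f * (n * f) = (\<Sum>m\<in>S. smul (c m) (f * (m * f)))"
    unfolding S(3) by (simp add: sum_distrib_left sum_distrib_right smul_mult_left smul_mult_right)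
  also have "\<dots> \<in> B" by (rule B_sum) (use f(2) B_smul in blast)
  finally have "f * (n * f) \<in> B" .
  moreover have "f * (n * f) \<in> U"
    using ultra_mult_rng[OF U nfilter_mult_src[OF nf n f(1)]] f(1) iso by simp
  ultimately show "scalar_germ U" by (intro scalar_germ_if_in_B[OF U])
qed

lemma principal_iff_spanned:
  "principal_groupoid G \<longleftrightarrow> UNIV = lin_span smul (free_normalisers B)"
proof
  assume pr: "principal_groupoid G"
  have "a \<in> lin_span smul (free_normalisers B)" for a
  proof -
    obtain S c where S: "S \<subseteq> N" "a = (\<Sum>m\<in>S. smul (c m) m)"
      using A_span unfolding lin_span_def by blast
    show ?thesis
      unfolding S(2)
      by (rule lin_span_sum, rule lin_span_smul, rule principal_imp_spanned[OF pr]) (use S(1) in blast)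
  qed
  then show "UNIV = lin_span smul (free_normalisers B)" by blast
qed (rule spanned_imp_principal)

end

theorem proposition7p1:
  fixes smul :: "'r::{comm_ring,comm_monoid_mult} \<Rightarrow> 'a::ring \<Rightarrow> 'a"
    and B :: "'a set"
  assumes "ring_algebra smul"
    and "alg_quasi_Cartan_pair smul B"
  shows "(alg_Cartan_pair smul B \<longleftrightarrow> effective_groupoid (G_groupoid smul B)) \<and>
         (alg_diagonal_pair smul B \<longleftrightarrow> principal_groupoid (G_groupoid smul B))"
proof -
  have base: "base_pair smul B"
    using assms(2) unfolding alg_quasi_Cartan_pair_def by blast
  note facts = base[unfolded base_pair_def]
  from facts have "\<exists>P. cond_expectation smul B P \<and> faithful B P" by (elim conjE)
  then obtain P where P: "cond_expectation smul B P" "faithful B P" by blast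
  interpret ring_algebra smul by (rule assms(1))
  interpret algebraic_pair smul B P
  proof unfold_locales
    from facts show "comm_subalgebra smul B" by (elim conjE)
    from facts show "local_units (idems B)" by (elim conjE)
    from facts show "B = lin_span smul (idems B)" by (elim conjE)
    from facts show "UNIV = lin_span smul (normalisers B)" by (elim conjE)
    from facts have "\<forall>t. \<forall>e\<in>idems B - {0}. smul t e = 0 \<longrightarrow> t = 0" by (elim conjE)
    then show "t = 0" if "e \<in> idems B" "e \<noteq> 0" "smul t e = 0" for t e
      using that by blast
  qed (rule P)+
  show ?thesis
    unfolding alg_Cartan_pair_def alg_diagonal_pair_def
    using base principal_iff_spanned maximal_comm_imp_effective effective_imp_maximal_comm
    by (intro conjI iffI) simp_all
qed

end
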